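(* Let $X_k,Y_k\in\mathbb R^{m\times n}$ ($k=1,\dots,p$, $X_{p+1}=X_1$) be the solution of the PGCS equation $A_kX_k-Y_kB_k=E_k$, $C_kX_{k+1}-Y_kD_k=F_k$ ($k=1,\dots,p$), whose coefficient matrix $W$ (defined in the context) is nonsingular. Let $\Delta A_k,\Delta C_k\in\mathbb R^{m\times m}$, $\Delta B_k,\Delta D_k\in\mathbb R^{n\times n}$, $\Delta E_k,\Delta F_k\in\mathbb R^{m\times n}$ be perturbations, and consider the perturbed PGCS equation $$(A_k+\Delta A_k)(X_k+\Delta X_k)-(Y_k+\Delta Y_k)(B_k+\Delta B_k)=E_k+\Delta E_k,$$ $$(C_k+\Delta C_k)(X_{k+1}+\Delta X_{k+1})-(Y_k+\Delta Y_k)(D_k+\Delta D_k)=F_k+\Delta F_k,\qquad k=1,\dots,p,$$ in the unknowns $\Delta X_k,\Delta Y_k\in\mathbb R^{m\times n}$ ($k=1,\dots,p$), with $\Delta X_{p+1}=\Delta X_1$. Let $\alpha_k,\beta_k,\gamma_k,\zeta_k,\tau_k,\delta_k>0$ be given tolerances. If the spectral radius of the entrywise absolute value $|W^{-1}\Delta W|$ is less than $1$, then the perturbed PGCS equation has a unique solution, and, entrywise, $$\mathrm{vec}\big(\big|[\Delta X_1,\Delta Y_1,\dots,\Delta X_p,\Delta Y_p]\big|\big)\le\big(I-|W^{-1}\Delta W|\big)^{-1}\,|W^{-1}H_1u|.$$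
   Context: Setting: $p,m,n\ge1$ are integers; $A_k,C_k\in\mathbb R^{m\times m}$, $B_k,D_k\in\mathbb R^{n\times n}$, $E_k,F_k\in\mathbb R^{m\times n}$ ($k=1,\dots,p$) are given. $\otimes$ is the Kronecker product, $\mathrm{vec}$ stacks the columns of a matrix one underneath the other, $I$ is an identity matrix of appropriate order. For a matrix or vector $M=(m_{ij})$, $|M|=(|m_{ij}|)$, and inequalities between vectors are entrywise. The PGCS equation is equivalent to $Wz=g$ with $z=\mathrm{vec}([X_1,Y_1,\dots,X_p,Y_p])$, $g=\mathrm{vec}([E_1,F_1,\dots,E_p,F_p])$, where $W\in\mathbb R^{2pmn\times 2pmn}$ is the matrix of the linear map sending $\mathrm{vec}([X_1,Y_1,\dots,X_p,Y_p])$ to $\mathrm{vec}([A_1X_1-Y_1B_1,\ C_1X_2-Y_1D_1,\ \dots,\ A_pX_p-Y_pB_p,\ C_pX_1-Y_pD_p])$. That is, in $mn\times mn$ blocks, block row $2k-1$ has $I\otimes A_k$ in the column of $X_k$ and $-(B_k^T\otimes I)$ in the column of $Y_k$; block row $2k$ has $-(D_k^T\otimes I)$ in the column of $Y_k$ and $I\otimes C_k$ in the column of $X_{k+1}$ (with $X_{p+1}=X_1$); all other blocks are zero. $\Delta W$ is the same matrix as $W$ with $A_k,B_k,C_k,D_k$ replaced by $\Delta A_k,\Delta B_k,\Delta C_k,\Delta D_k$. $H_1=\mathrm{diag}(H_{1,1},\dots,H_{1,p})$ is block diagonal with $$H_{1,k}=\begin{bmatrix}\alpha_k(X_k^T\otimes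 I)&-\beta_k(I\otimes Y_k)&-\gamma_kI&0&0&0\\0&0&0&\zeta_k(X_{k+1}^T\otimes I)&-\tau_k(I\otimes Y_k)&-\delta_kI\end{bmatrix},$$ and $u$ is the column vector obtained by stacking, for $k=1,\dots,p$ in order, the vectors $\mathrm{vec}(\Delta A_k)/\alpha_k$, $\mathrm{vec}(\Delta B_k)/\beta_k$, $\mathrm{vec}(\Delta E_k)/\gamma_k$, $\mathrm{vec}(\Delta C_k)/\zeta_k$, $\mathrm{vec}(\Delta D_k)/\tau_k$, $\mathrm{vec}(\Delta F_k)/\delta_k$. *)

theory Defs
  imports
    "Jordan_Normal_Form.Spectral_Radius"
    "Jordan_Normal_Form.Gauss_Jordan_Elimination"
    "HOL-Library.FuncSet"
begin

text \<open>
  Families of matrices are functions on \<open>nat\<close> of which only the values at \<open>k < p\<close> matter: the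
  index \<open>k = 0, \<dots>, p - 1\<close> stands for \<open>k + 1\<close> in the usual numbering \<open>1, \<dots>, p\<close>. The cyclic
  successor (\<open>X\<^sub>p\<^sub>+\<^sub>1 = X\<^sub>1\<close>) is thus \<open>Suc k mod p\<close>.
\<close>

definition kronecker :: "'a :: times mat \<Rightarrow> 'a mat \<Rightarrow> 'a mat" where
  "kronecker A B = mat (dim_row A * dim_row B) (dim_col A * dim_col B)
     (\<lambda>(i, j). A $$ (i div dim_row B, j div dim_col B) * B $$ (i mod dim_row B, j mod dim_col B))"

text \<open>The columns of a matrix stacked one underneath the other.\<close>

definition vec_of_mat :: "'a mat \<Rightarrow> 'a vec" where
  "vec_of_mat A = vec (dim_row A * dim_col A) (\<lambda>i. A $$ (i mod dim_row A, i div dim_row A))"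

definition stack_vecs :: "'a vec list \<Rightarrow> 'a vec" where
  "stack_vecs vs = vec_of_list (concat (map list_of_vec vs))"

text \<open>The block row \<open>[M\<^sub>1, M\<^sub>2, \<dots>]\<close> of matrices with \<open>r\<close> rows each.\<close>

definition hcat :: "nat \<Rightarrow> 'a mat list \<Rightarrow> 'a mat" where
  "hcat r Ms = mat_of_cols r (concat (map cols Ms))"

text \<open>The matrix of \<open>s \<times> s\<close> blocks, each of them a \<open>d \<times> d\<close> matrix, with \<open>G i j\<close> as block \<open>(i, j)\<close>.\<close>

definition block_mat :: "nat \<Rightarrow> nat \<Rightarrow> (nat \<Rightarrow> nat \<Rightarrow> 'a mat) \<Rightarrow> 'a mat" where
  "block_mat s d G = mat (s * d) (s * d) (\<lambda>(i, j). G (i div d) (j div d) $$ (i mod d, j mod d))"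

abbreviation abs_mat :: "real mat \<Rightarrow> real mat" where
  "abs_mat \<equiv> map_mat abs"

abbreviation abs_vec :: "real vec \<Rightarrow> real vec" where
  "abs_vec \<equiv> map_vec abs"

text \<open>Unspecified unless the matrix is invertible.\<close>

abbreviation inv_mat :: "real mat \<Rightarrow> real mat" where
  "inv_mat M \<equiv> the (mat_inverse M)"

definition pgcs_eq :: "nat \<Rightarrow> (nat \<Rightarrow> real mat) \<Rightarrow> (nat \<Rightarrow> real mat) \<Rightarrow> (nat \<Rightarrow> real mat)
    \<Rightarrow> (nat \<Rightarrow> real mat) \<Rightarrow> (nat \<Rightarrow> real mat) \<Rightarrow> (nat \<Rightarrow> real mat)
    \<Rightarrow> (nat \<Rightarrow> real mat) \<Rightarrow> (nat \<Rightarrow> real mat) \<Rightarrow> bool" where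
  "pgcs_eq p A B C D E F X Y \<longleftrightarrow>
     (\<forall>k<p. A k * X k - Y k * B k = E k \<and> C k * X (Suc k mod p) - Y k * D k = F k)"

text \<open>\<open>[X\<^sub>1, Y\<^sub>1, \<dots>, X\<^sub>p, Y\<^sub>p]\<close>\<close>

definition interleave :: "nat \<Rightarrow> nat \<Rightarrow> (nat \<Rightarrow> real mat) \<Rightarrow> (nat \<Rightarrow> real mat) \<Rightarrow> real mat" where
  "interleave p m X Y = hcat m (concat (map (\<lambda>k. [X k, Y k]) [0..<p]))"

text \<open>
  The matrix \<open>W\<close>. Counting from 0, \<open>X k\<close> belongs to block column \<open>2 * k\<close> and \<open>Y k\<close> to \<open>2 * k + 1\<close>;
  the equations with right-hand sides \<open>E k\<close> and \<open>F k\<close> are block rows \<open>2 * k\<close> and \<open>2 * k + 1\<close>.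
\<close>

definition pgcs_mat :: "nat \<Rightarrow> nat \<Rightarrow> nat \<Rightarrow> (nat \<Rightarrow> real mat) \<Rightarrow> (nat \<Rightarrow> real mat)
    \<Rightarrow> (nat \<Rightarrow> real mat) \<Rightarrow> (nat \<Rightarrow> real mat) \<Rightarrow> real mat" where
  "pgcs_mat p m n A B C D = block_mat (2 * p) (m * n) (\<lambda>i j. let k = i div 2 in
     if even i then
       if j = 2 * k then kronecker (1\<^sub>m n) (A k)
       else if j = 2 * k + 1 then - kronecker (transpose_mat (B k)) (1\<^sub>m m)
       else 0\<^sub>m (m * n) (m * n)
     else
       if j = 2 * k + 1 then - kronecker (transpose_mat (D k)) (1\<^sub>m m)
       else if j = 2 * (Suc k mod p) then kronecker (1\<^sub>m n) (C k)
       else 0\<^sub>m (m * n) (m * n))"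

text \<open>The arguments \<open>X\<close>, \<open>X'\<close>, \<open>Y\<close> are \<open>X\<^sub>k\<close>, \<open>X\<^sub>k\<^sub>+\<^sub>1\<close>, \<open>Y\<^sub>k\<close>.\<close>

definition H1_block :: "nat \<Rightarrow> nat \<Rightarrow> real \<Rightarrow> real \<Rightarrow> real \<Rightarrow> real \<Rightarrow> real \<Rightarrow> real
    \<Rightarrow> real mat \<Rightarrow> real mat \<Rightarrow> real mat \<Rightarrow> real mat" where
  "H1_block m n \<alpha> \<beta> \<gamma> \<zeta> \<tau> \<delta> X X' Y =
     hcat (m * n)
       [\<alpha> \<cdot>\<^sub>m kronecker (transpose_mat X) (1\<^sub>m m), - (\<beta> \<cdot>\<^sub>m kronecker (1\<^sub>m n) Y), - (\<gamma> \<cdot>\<^sub>m 1\<^sub>m (m * n)),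
        0\<^sub>m (m * n) (m * m), 0\<^sub>m (m * n) (n * n), 0\<^sub>m (m * n) (m * n)]
     @\<^sub>r
     hcat (m * n)
       [0\<^sub>m (m * n) (m * m), 0\<^sub>m (m * n) (n * n), 0\<^sub>m (m * n) (m * n),
        \<zeta> \<cdot>\<^sub>m kronecker (transpose_mat X') (1\<^sub>m m), - (\<tau> \<cdot>\<^sub>m kronecker (1\<^sub>m n) Y), - (\<delta> \<cdot>\<^sub>m 1\<^sub>m (m * n))]"

definition H1 :: "nat \<Rightarrow> nat \<Rightarrow> nat \<Rightarrow> (nat \<Rightarrow> real) \<Rightarrow> (nat \<Rightarrow> real) \<Rightarrow> (nat \<Rightarrow> real)
    \<Rightarrow> (nat \<Rightarrow> real) \<Rightarrow> (nat \<Rightarrow> real) \<Rightarrow> (nat \<Rightarrow> real)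
    \<Rightarrow> (nat \<Rightarrow> real mat) \<Rightarrow> (nat \<Rightarrow> real mat) \<Rightarrow> real mat" where
  "H1 p m n \<alpha> \<beta> \<gamma> \<zeta> \<tau> \<delta> X Y = diag_block_mat (map (\<lambda>k.
     H1_block m n (\<alpha> k) (\<beta> k) (\<gamma> k) (\<zeta> k) (\<tau> k) (\<delta> k) (X k) (X (Suc k mod p)) (Y k)) [0..<p])"

definition scaled_perturbation :: "nat \<Rightarrow> (nat \<Rightarrow> real) \<Rightarrow> (nat \<Rightarrow> real) \<Rightarrow> (nat \<Rightarrow> real)
    \<Rightarrow> (nat \<Rightarrow> real) \<Rightarrow> (nat \<Rightarrow> real) \<Rightarrow> (nat \<Rightarrow> real)
    \<Rightarrow> (nat \<Rightarrow> real mat) \<Rightarrow> (nat \<Rightarrow> real mat) \<Rightarrow> (nat \<Rightarrow> real mat)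
    \<Rightarrow> (nat \<Rightarrow> real mat) \<Rightarrow> (nat \<Rightarrow> real mat) \<Rightarrow> (nat \<Rightarrow> real mat) \<Rightarrow> real vec" where
  "scaled_perturbation p \<alpha> \<beta> \<gamma> \<zeta> \<tau> \<delta> \<Delta>A \<Delta>B \<Delta>C \<Delta>D \<Delta>E \<Delta>F = stack_vecs (concat (map (\<lambda>k.
     [(1 / \<alpha> k) \<cdot>\<^sub>v vec_of_mat (\<Delta>A k), (1 / \<beta> k) \<cdot>\<^sub>v vec_of_mat (\<Delta>B k),
      (1 / \<gamma> k) \<cdot>\<^sub>v vec_of_mat (\<Delta>E k), (1 / \<zeta> k) \<cdot>\<^sub>v vec_of_mat (\<Delta>C k),
      (1 / \<tau> k) \<cdot>\<^sub>v vec_of_mat (\<Delta>D k), (1 / \<delta> k) \<cdot>\<^sub>v vec_of_mat (\<Delta>F k)]) [0..<p]))"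

end

theory Submission
  imports Defs
begin

text \<open>
  Write \<open>z\<close> for the stacked vector of the \<open>\<Delta>X\<^sub>k, \<Delta>Y\<^sub>k\<close>. Subtracting the unperturbed from the perturbed
  equation leaves \<open>(W + \<Delta>W) z = - H\<^sub>1 u\<close>, that is \<open>(I + N) z = - b\<close> with \<open>N = W\<^sup>-\<^sup>1 \<Delta>W\<close> and
  \<open>b = W\<^sup>-\<^sup>1 H\<^sub>1 u\<close>. Hence \<open>|z| \<le> |b| + |N| |z|\<close>. Since \<open>|N|\<close> is nonnegative of spectral radius below 1,
  \<open>|N| y \<le> y\<close> forces \<open>y \<ge> 0\<close>; applied to \<open>y = (I - |N|)\<^sup>-\<^sup>1 |b| - |z|\<close> this is the claimed bound, and
  the case \<open>b = 0\<close> shows that \<open>I + N\<close> is injective, which gives existence and uniqueness.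
\<close>

section \<open>Nonnegative matrices of spectral radius below 1\<close>

text \<open>Nothing is linearised: second-order products such as
  \<open>\<Delta>A k * \<Delta>X k\<close> are linear in the unknowns and make up the term with
  \<open>\<Delta>W\<close>. What is free of the unknowns is the residual
  \<open>\<Delta>A k * X k - Y k * \<Delta>B k - \<Delta>E k\<close> (and its companion) that the
  old solution leaves in the new equation; it is \<open>H1 u\<close> because each tolerance in
  \<open>H1\<close> meets its reciprocal in \<open>u\<close>. No Neumann series is summed: the
  inverse of I - |N| enters only through the equation that its image solves, and the order comes
  from the sign lemma on |N| y \<le> y. The spectral condition is on |N|, while I + N has to be
  inverted; absolute values of a kernel vector remove the sign and lead back to |N|. Families are
  functions on all of \<open>nat\<close>, so uniqueness makes sense only for functions that are
  fixed outside k < p; hence the extensional function spaces.\<close>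

lemma nonneg_mult_mat_vec_mono:
  fixes A :: "real mat"
  assumes A: "A \<in> carrier_mat n n" and nonneg: "\<And>i j. i < n \<Longrightarrow> j < n \<Longrightarrow> A $$ (i, j) \<ge> 0"
    and v: "v \<in> carrier_vec n" and w: "w \<in> carrier_vec n" and le: "v \<le> w"
  shows "A *\<^sub>v v \<le> A *\<^sub>v w"
  using assms unfolding less_eq_vec_def scalar_prod_def
  by (auto simp: scalar_prod_def intro!: sum_mono mult_left_mono)

lemma abs_mult_mat_vec_le:
  fixes A :: "real mat"
  assumes A: "A \<in> carrier_mat n n" and v: "v \<in> carrier_vec n"
  shows "abs_vec (A *\<^sub>v v) \<le> abs_mat A *\<^sub>v abs_vec v"
  using assms unfolding less_eq_vec_def
  by (auto simp: scalar_prod_def abs_mult[symmetric])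

text \<open>An eigenvalue of largest modulus of the scaled matrix, divided by \<open>r\<close>, is
  an eigenvalue of \<open>A\<close>. Positive dimension makes the spectrum nonempty, so that the
  maximum is attained.\<close>

lemma spectral_radius_smult_less_1:
  assumes A: "A \<in> carrier_mat n n" and n: "n > 0" and r: "r > 0"
    and lt: "r * spectral_radius A < 1"
  shows "spectral_radius (of_real r \<cdot>\<^sub>m A) < 1"
proof -
  let ?R = "of_real r \<cdot>\<^sub>m A"
  have R: "?R \<in> carrier_mat n n" using A by simp
  from spectral_radius_mem_max(1)[OF R n] obtain ev
    where ev: "eigenvalue ?R ev" and sr: "spectral_radius ?R = norm ev"
    by (auto simp: spectrum_def)
  then obtain v where v: "v \<in> carrier_vec n" "v \<noteq> 0\<^sub>v n" "?R *\<^sub>v v = ev \<cdot>\<^sub>v v"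
    using A unfolding eigenvalue_def eigenvector_def by auto
  have "of_real r \<cdot>\<^sub>v (A *\<^sub>v v) = ?R *\<^sub>v v"
    using v(1) A by (intro eq_vecI) (auto simp: scalar_prod_def sum_distrib_left mult.assoc)
  then have "of_real r \<cdot>\<^sub>v (A *\<^sub>v v) = ev \<cdot>\<^sub>v v" using v by simp
  then have "A *\<^sub>v v = (1 / of_real r) \<cdot>\<^sub>v (ev \<cdot>\<^sub>v v)"
    using r by (metis (no_types, lifting) divide_self_if less_numeral_extra(3) mult.commute
        of_real_eq_0_iff one_smult_vec smult_smult_assoc times_divide_eq_right mult.right_neutral)
  then have "eigenvalue A (ev / of_real r)"
    using v A unfolding eigenvalue_def eigenvector_def
    by (intro exI[of _ v]) (simp add: smult_smult_assoc)
  then have "norm (ev / of_real r) \<le> spectral_radius A"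
    by (intro spectral_radius_mem_max(2)[OF A n]) (simp add: spectrum_def)
  then have "norm ev \<le> r * spectral_radius A"
    using r by (simp add: norm_divide field_simps)
  then show ?thesis using sr lt by simp
qed

text \<open>
  Some \<open>R = r M\<close> with \<open>r > 1\<close> still has spectral radius below 1, hence bounded powers, and
  \<open>R\<^sup>k y \<le> r\<^sup>k y\<close> bounds \<open>y\<close> from below by a null sequence.
\<close>

lemma nonneg_of_mult_mat_vec_le:
  fixes M :: "real mat"
  assumes M: "M \<in> carrier_mat n n" and nonneg: "\<And>i j. i < n \<Longrightarrow> j < n \<Longrightarrow> M $$ (i, j) \<ge> 0"
    and sr: "spectral_radius (map_mat complex_of_real M) < 1"
    and y: "y \<in> carrier_vec n" and le: "M *\<^sub>v y \<le> y"
  shows "0\<^sub>v n \<le> y"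
proof (cases "n = 0")
  \<comment> \<open>In dimension 0 the spectrum is empty and has no maximum; the claim is
    void.\<close>
  case True
  then show ?thesis using y by (simp add: less_eq_vec_def)
next
  case False
  then have n: "n > 0" by simp
  let ?c = "map_mat complex_of_real"
  define \<rho> where "\<rho> = spectral_radius (?c M)"
  have cM: "?c M \<in> carrier_mat n n" using M by simp
  have \<rho>0: "\<rho> \<ge> 0" using spectral_radius_mem_max(1)[OF cM n] unfolding \<rho>_def by auto
  \<comment> \<open>A number strictly between 1 and \<open>1 / \<rho>\<close> that also covers
    \<rho> = 0: the product r * \<rho> = 2 * \<rho> / (1 + \<rho>) is below 1 because \<rho>
    is.\<close>
  define r where "r = 2 / (1 + \<rho>)"
  have \<rho>1: "\<rho> < 1" using sr \<rho>_def by simp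
  have r: "r > 1" "r * \<rho> < 1" using \<rho>0 \<rho>1 unfolding r_def by (auto simp: field_simps)
  define R where "R = r \<cdot>\<^sub>m M"
  have R: "R \<in> carrier_mat n n" using M R_def by simp
  have cR: "?c R = of_real r \<cdot>\<^sub>m ?c M" unfolding R_def by (rule eq_matI) auto
  have "spectral_radius (?c R) < 1" unfolding cR
    using r by (intro spectral_radius_smult_less_1[OF cM n]) (auto simp: \<rho>_def)
  \<comment> \<open>The Jordan normal form bounds all entries of all powers by one constant.\<close>
  then obtain b where b: "\<And>k. norm_bound (?c R ^\<^sub>m k) b"
    using spectral_radius_jnf_norm_bound_less_1_upper_triangular[of "?c R" n] R by auto
  have Rk: "R ^\<^sub>m k \<in> carrier_mat n n" for k using R by simp
  have bound: "\<bar>(R ^\<^sub>m k) $$ (i, j)\<bar> \<le> b" if "i < n" "j < n" for i j k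
  proof -
    have "?c R ^\<^sub>m k = ?c (R ^\<^sub>m k)" by (rule of_real_hom.mat_hom_pow[OF R, symmetric])
    then show ?thesis using b[of k] that Rk[of k] carrier_matD[OF Rk[of k]] unfolding norm_bound_def by auto
  qed
  have Rnn: "i < n \<Longrightarrow> j < n \<Longrightarrow> R $$ (i, j) \<ge> 0" for i j
    using nonneg r M by (simp add: R_def)
  have Ry: "R *\<^sub>v y \<le> r \<cdot>\<^sub>v y"
    using le r M y unfolding R_def less_eq_vec_def by auto
  \<comment> \<open>\<open>z\<close> is generalised because the power k + 1 acts on z as the power k
    on R z; R z inherits the premise since \<open>R\<close> is nonnegative, hence monotone.\<close>
  have pow: "(R ^\<^sub>m k) *\<^sub>v z \<le> r ^ k \<cdot>\<^sub>v z"
    if "z \<in> carrier_vec n" "R *\<^sub>v z \<le> r \<cdot>\<^sub>v z" for k z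
    using that
  proof (induction k arbitrary: z)
    case 0
    then show ?case using R by simp
  next
    case (Suc k)
    have Rz: "R *\<^sub>v z \<in> carrier_vec n" using R Suc.prems by simp
    have "R *\<^sub>v (R *\<^sub>v z) \<le> R *\<^sub>v (r \<cdot>\<^sub>v z)"
      using Suc.prems by (intro nonneg_mult_mat_vec_mono[OF R Rnn Rz]) auto
    also have "\<dots> = r \<cdot>\<^sub>v (R *\<^sub>v z)" by (rule mult_mat_vec[OF R Suc.prems(1)])
    finally have "(R ^\<^sub>m k) *\<^sub>v (R *\<^sub>v z) \<le> r ^ k \<cdot>\<^sub>v (R *\<^sub>v z)"
      by (rule Suc.IH[OF Rz])
    also have "\<dots> \<le> r ^ k \<cdot>\<^sub>v (r \<cdot>\<^sub>v z)"
      using Suc.prems r R unfolding less_eq_vec_def by (auto intro!: mult_left_mono)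
    finally show ?case
      using R Rk[of k] Suc.prems
      by (simp add: smult_smult_assoc mult.commute assoc_mult_mat_vec[OF Rk R Suc.prems(1)])
  qed
  have "y $ i \<ge> 0" if i: "i < n" for i
  proof -
    define S where "S = (\<Sum>j<n. b * \<bar>y $ j\<bar>)"
    \<comment> \<open>Entry i of R^k y is at most \<open>S\<close> in modulus for every k; dividing
      by r^k makes the lower bound on y_i tend to 0.\<close>
    have low: "- S * inverse r ^ k \<le> y $ i" for k
    proof -
      have "\<bar>((R ^\<^sub>m k) *\<^sub>v y) $ i\<bar> = \<bar>\<Sum>j<n. (R ^\<^sub>m k) $$ (i, j) * y $ j\<bar>"
        using i y Rk[of k] carrier_matD[OF Rk[of k]] by (simp add: scalar_prod_def lessThan_atLeast0)
      also have "\<dots> \<le> S" unfolding S_def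
        using i bound by (intro order.trans[OF sum_abs] sum_mono) (auto simp: abs_mult intro!: mult_right_mono)
      finally have "- S \<le> ((R ^\<^sub>m k) *\<^sub>v y) $ i" by simp
      also have "\<dots> \<le> r ^ k * y $ i" using pow[OF y Ry, of k] i y unfolding less_eq_vec_def by auto
      finally show ?thesis using r by (simp add: field_simps)
    qed
    have "(\<lambda>k. - S * inverse r ^ k) \<longlonglongrightarrow> - S * 0"
      using r by (intro tendsto_mult tendsto_const LIMSEQ_realpow_zero) (auto simp: inverse_less_1_iff)
    then show ?thesis using low by (intro LIMSEQ_le_const2[of _ 0]) auto
  qed
  then show ?thesis using y by (simp add: less_eq_vec_def)
qed

section \<open>Invertibility from a trivial kernel, and the computed inverse\<close>

lemma invertible_mat_iff_Units:
  fixes A :: "'a :: field mat"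
  assumes A: "A \<in> carrier_mat n n"
  shows "invertible_mat A \<longleftrightarrow> A \<in> Units (ring_mat TYPE('a) n b)"
proof
  assume "invertible_mat A"
  then obtain B where B: "A * B = 1\<^sub>m n" "B * A = 1\<^sub>m (dim_row B)"
    using A unfolding invertible_mat_def inverts_mat_def by auto
  \<comment> \<open>\<open>invertible_mat\<close> leaves the shape of the inverse open; the column
    counts of the two products fix it.\<close>
  have "dim_col B = n" "dim_row B = n"
    using arg_cong[OF B(1), of dim_col] arg_cong[OF B(2), of dim_col] A by auto
  then show "A \<in> Units (ring_mat TYPE('a) n b)"
    using A B by (auto simp: Units_def ring_mat_def intro!: bexI[of _ B])
next
  assume "A \<in> Units (ring_mat TYPE('a) n b)"
  then show "invertible_mat A"
    using A by (auto simp: Units_def ring_mat_def invertible_mat_def inverts_mat_def)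
qed

text \<open>A zero determinant would yield a nonzero kernel vector; a nonzero one makes the matrix a
  unit of the matrix ring, which translates back to \<open>invertible_mat\<close>.\<close>

lemma invertible_matI_kernel:
  fixes A :: "'a :: field mat"
  assumes A: "A \<in> carrier_mat n n"
    and inj: "\<And>v. v \<in> carrier_vec n \<Longrightarrow> A *\<^sub>v v = 0\<^sub>v n \<Longrightarrow> v = 0\<^sub>v n"
  shows "invertible_mat A"
proof -
  have "det A \<noteq> 0" using det_0_iff_vec_prod_zero_field[OF A] inj by auto
  then show ?thesis
    using det_non_zero_imp_unit[OF A, of "()"] invertible_mat_iff_Units[OF A, of "()"] by blast
qed

text \<open>Gives \<open>inv_mat\<close> its meaning: the outcome \<open>None\<close> would say that
  the matrix is not a unit.\<close>

lemma inv_mat_invertible: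
  assumes A: "A \<in> carrier_mat n n" and inv: "invertible_mat A"
  shows "inv_mat A \<in> carrier_mat n n" "inv_mat A * A = 1\<^sub>m n" "A * inv_mat A = 1\<^sub>m n"
proof -
  obtain B where B: "mat_inverse A = Some B"
    using mat_inverse(1)[OF A, of "()"] inv invertible_mat_iff_Units[OF A, of "()"]
    by (cases "mat_inverse A") auto
  then show "inv_mat A \<in> carrier_mat n n" "inv_mat A * A = 1\<^sub>m n" "A * inv_mat A = 1\<^sub>m n"
    using mat_inverse(2)[OF A B] by auto
qed

section \<open>Inverting I - |N| and I + N\<close>

context
  fixes n :: nat and N :: "real mat"
  assumes N: "N \<in> carrier_mat n n"
    and sr: "spectral_radius (map_mat complex_of_real (abs_mat N)) < 1"
begin

lemma abs_mat_nonneg_of_le: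
  assumes "y \<in> carrier_vec n" "abs_mat N *\<^sub>v y \<le> y"
  shows "0\<^sub>v n \<le> y"
  using N assms by (intro nonneg_of_mult_mat_vec_le[OF _ _ sr]) auto

text \<open>A kernel vector is a fixed point of |N|, so the sign lemma applies to \<open>v\<close>
  and to \<open>- v\<close> and leaves only zero.\<close>

lemma invertible_one_minus_abs_mat: "invertible_mat (1\<^sub>m n - abs_mat N)"
proof (rule invertible_matI_kernel)
  fix v assume v: "v \<in> carrier_vec n" and 0: "(1\<^sub>m n - abs_mat N) *\<^sub>v v = 0\<^sub>v n"
  have aN: "abs_mat N \<in> carrier_mat n n" using N by simp
  have "v - abs_mat N *\<^sub>v v = 0\<^sub>v n"
    using 0 minus_mult_distrib_mat_vec[OF one_carrier_mat aN v] v by simp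
  then have eq: "(abs_mat N *\<^sub>v v) $ i = v $ i" if "i < n" for i
    using that v N by (auto dest: arg_cong[of _ _ "\<lambda>x. x $ i"])
  have "0\<^sub>v n \<le> v" using v N eq by (intro abs_mat_nonneg_of_le) (auto simp: less_eq_vec_def)
  moreover have "abs_mat N *\<^sub>v (- v) = - (abs_mat N *\<^sub>v v)"
    using v N by (intro eq_vecI) (auto simp: scalar_prod_def sum_negf)
  then have "0\<^sub>v n \<le> - v" using v N eq by (intro abs_mat_nonneg_of_le) (auto simp: less_eq_vec_def)
  ultimately show "v = 0\<^sub>v n" using v by (intro eq_vecI) (auto simp: less_eq_vec_def intro: antisym)
qed (use N in auto)

text \<open>The right-hand side x satisfies x - |N| x = b; inserting this into the hypothesis gives
  |N| (x - w) \<le> x - w. It is used with \<open>b\<close> zero for injectivity and with an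
  absolute value for the bound.\<close>

lemma le_inv_one_minus_abs_mat:
  assumes w: "w \<in> carrier_vec n" and b: "b \<in> carrier_vec n"
    and le: "w \<le> b + abs_mat N *\<^sub>v w"
  shows "w \<le> inv_mat (1\<^sub>m n - abs_mat N) *\<^sub>v b"
proof -
  let ?A = "1\<^sub>m n - abs_mat N" and ?x = "inv_mat (1\<^sub>m n - abs_mat N) *\<^sub>v b"
  have aN: "abs_mat N \<in> carrier_mat n n" using N by simp
  have A: "?A \<in> carrier_mat n n" using N by (simp add: minus_carrier_mat)
  note I = inv_mat_invertible[OF A invertible_one_minus_abs_mat]
  have x: "?x \<in> carrier_vec n" using I b by simp
  have "?A *\<^sub>v ?x = b" using I A b by (metis assoc_mult_mat_vec one_mult_mat_vec)
  then have "?x - abs_mat N *\<^sub>v ?x = b"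
    using minus_mult_distrib_mat_vec[OF one_carrier_mat aN x] x by simp
  then have eq: "?x $ i - (abs_mat N *\<^sub>v ?x) $ i = b $ i" if "i < n" for i
    using that x N carrier_vecD[OF x] by (auto dest: arg_cong[of _ _ "\<lambda>x. x $ i"])
  have "0\<^sub>v n \<le> ?x - w"
  proof (rule abs_mat_nonneg_of_le)
    show "abs_mat N *\<^sub>v (?x - w) \<le> ?x - w"
      unfolding mult_minus_distrib_mat_vec[OF aN x w]
      using eq le x w b N unfolding less_eq_vec_def by (auto simp: algebra_simps)
  qed (use x w in auto)
  then show ?thesis using x w I(1) unfolding less_eq_vec_def by auto
qed

text \<open>From v = - N v follows |v| \<le> |N| |v|, and the comparison with \<open>b\<close> zero
  gives |v| \<le> 0.\<close>

lemma invertible_one_plus_mat: "invertible_mat (1\<^sub>m n + N)"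
proof (rule invertible_matI_kernel)
  fix v assume v: "v \<in> carrier_vec n" and 0: "(1\<^sub>m n + N) *\<^sub>v v = 0\<^sub>v n"
  have "v + N *\<^sub>v v = 0\<^sub>v n"
    using 0 add_mult_distrib_mat_vec[OF one_carrier_mat N v] v by simp
  then have "v $ i + (N *\<^sub>v v) $ i = 0" if "i < n" for i
    using that v N by (auto dest: arg_cong[of _ _ "\<lambda>x. x $ i"])
  then have "abs_vec v = abs_vec (N *\<^sub>v v)"
    using v N by (intro eq_vecI) (auto simp: abs_if, (smt (verit))+)
  then have "abs_vec v \<le> abs_mat N *\<^sub>v abs_vec v"
    using abs_mult_mat_vec_le[OF N v] by simp
  then have "abs_vec v \<le> 0\<^sub>v n + abs_mat N *\<^sub>v abs_vec v"
    using N by (auto simp: less_eq_vec_def)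
  from le_inv_one_minus_abs_mat[OF _ _ this] v
  have "abs_vec v \<le> inv_mat (1\<^sub>m n - abs_mat N) *\<^sub>v 0\<^sub>v n" by simp
  also have "\<dots> = 0\<^sub>v n"
    using inv_mat_invertible(1)[OF _ invertible_one_minus_abs_mat, of n] N
    by (auto simp: minus_carrier_mat)
  finally show "v = 0\<^sub>v n" using v by (intro eq_vecI) (auto simp: less_eq_vec_def)
qed (use N in auto)

end

section \<open>Kronecker products and vectorization\<close>

lemma index_vec_of_mat:
  assumes "A \<in> carrier_mat r c"
  shows "i < r * c \<Longrightarrow> vec_of_mat A $ i = A $$ (i mod r, i div r)"
    and "dim_vec (vec_of_mat A) = r * c"
  using assms by (auto simp: vec_of_mat_def)

lemma vec_of_mat_carrier [simp]: "A \<in> carrier_mat r c \<Longrightarrow> vec_of_mat A \<in> carrier_vec (r * c)"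
  by (auto simp: vec_of_mat_def)

lemma dim_kronecker [simp]:
  "dim_row (kronecker A B) = dim_row A * dim_row B" "dim_col (kronecker A B) = dim_col A * dim_col B"
  by (auto simp: kronecker_def)

lemma mod_div_lt_mult:
  assumes "(i::nat) < r * c"
  shows "i mod r < r" "i div r < c"
  using assms by (cases "r = 0"; auto simp: less_mult_imp_div_less mult.commute)+

lemma sum_lessThan_add:
  fixes f :: "nat \<Rightarrow> 'a :: comm_monoid_add"
  shows "(\<Sum>l<a + b. f l) = (\<Sum>l<a. f l) + (\<Sum>l<b. f (a + l))"
  by (induction b) (simp_all add: add.assoc)

text \<open>The substitution l = j * r + k, inverse to \<open>div\<close> and \<open>mod\<close>; it
  makes double sums of the products with Kronecker and block matrices.\<close>

lemma sum_lessThan_mult: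
  fixes f :: "nat \<Rightarrow> 'a :: comm_monoid_add"
  shows "(\<Sum>l<c * r. f l) = (\<Sum>j<c. \<Sum>k<r. f (j * r + k))"
proof (induction c)
  case (Suc c)
  then show ?case using sum_lessThan_add[of f "c * r" r] by (simp add: add.commute)
qed simp

text \<open>The classical vec identity. Position l of vec X holds the entry in row l mod m and
  column l div m, so the sum over l is the double sum of A X B. Taking one factor to be the identity
  gives the two kinds of blocks in W and \<open>H1\<close>.\<close>

lemma kronecker_transpose_mult_vec:
  fixes A X B :: "'a :: comm_semiring_0 mat"
  assumes A: "A \<in> carrier_mat a m" and X: "X \<in> carrier_mat m n" and B: "B \<in> carrier_mat n b"
  shows "kronecker (transpose_mat B) A *\<^sub>v vec_of_mat X = vec_of_mat (A * X * B)"
proof (rule eq_vecI)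
  have AXB: "A * X * B \<in> carrier_mat a b" using A X B by simp
  show "dim_vec (kronecker (transpose_mat B) A *\<^sub>v vec_of_mat X) = dim_vec (vec_of_mat (A * X * B))"
    using A B by (simp add: vec_of_mat_def)
  fix i assume "i < dim_vec (vec_of_mat (A * X * B))"
  then have i: "i < a * b" using index_vec_of_mat(2)[OF AXB] by simp
  note ir = mod_div_lt_mult[OF i]
  have "(kronecker (transpose_mat B) A *\<^sub>v vec_of_mat X) $ i
      = (\<Sum>l<n * m. B $$ (l div m, i div a) * A $$ (i mod a, l mod m) * X $$ (l mod m, l div m))"
    using i A B X ir mod_div_lt_mult[of _ m n]
    by (auto simp: scalar_prod_def kronecker_def index_vec_of_mat[OF X]
        lessThan_atLeast0 mult.commute[of n] mult.commute[of b] intro!: sum.cong)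
  also have "\<dots> = (\<Sum>j<n. \<Sum>k<m. B $$ (j, i div a) * A $$ (i mod a, k) * X $$ (k, j))"
    unfolding sum_lessThan_mult by (intro sum.cong refl) simp
  also have "\<dots> = (A * X * B) $$ (i mod a, i div a)"
    using A X B ir
    by (auto simp: scalar_prod_def lessThan_atLeast0 sum_distrib_right sum_distrib_left mult_ac
        simp del: assoc_mult_mat intro!: sum.cong)
  finally show "(kronecker (transpose_mat B) A *\<^sub>v vec_of_mat X) $ i = vec_of_mat (A * X * B) $ i"
    using i by (simp add: index_vec_of_mat(1)[OF AXB])
qed

lemma kronecker_one_mult_vec:
  fixes A X :: "'a :: comm_semiring_1 mat"
  assumes "A \<in> carrier_mat a m" and "X \<in> carrier_mat m n"
  shows "kronecker (1\<^sub>m n) A *\<^sub>v vec_of_mat X = vec_of_mat (A * X)"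
  using kronecker_transpose_mult_vec[OF assms one_carrier_mat[of n]] assms by simp

lemma kronecker_transpose_one_mult_vec:
  fixes X B :: "'a :: comm_semiring_1 mat"
  assumes "X \<in> carrier_mat m n" and "B \<in> carrier_mat n b"
  shows "kronecker (transpose_mat B) (1\<^sub>m m) *\<^sub>v vec_of_mat X = vec_of_mat (X * B)"
  using kronecker_transpose_mult_vec[OF one_carrier_mat[of m] assms] assms by simp

section \<open>Stacked vectors and block matrices\<close>

lemma stack_vecs_simps [simp]:
  "stack_vecs [] = vNil" "stack_vecs (v # vs) = v @\<^sub>v stack_vecs vs"
proof -
  have "list_of_vec (stack_vecs (v # vs)) = list_of_vec (v @\<^sub>v stack_vecs vs)"
    by (simp add: stack_vecs_def list_vec)
  then show "stack_vecs (v # vs) = v @\<^sub>v stack_vecs vs" by (metis vec_list)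
qed (simp add: stack_vecs_def)

lemma stack_vecs_append: "stack_vecs (vs @ ws) = stack_vecs vs @\<^sub>v stack_vecs ws"
proof -
  have "list_of_vec (stack_vecs (vs @ ws)) = list_of_vec (stack_vecs vs @\<^sub>v stack_vecs ws)"
    by (simp add: stack_vecs_def list_vec)
  then show ?thesis by (metis vec_list)
qed

lemma stack_vecs_concat: "stack_vecs (concat vss) = stack_vecs (map stack_vecs vss)"
  by (induction vss) (simp_all add: stack_vecs_append)

lemma dim_stack_vecs: "dim_vec (stack_vecs vs) = sum_list (map dim_vec vs)"
  by (induction vs) simp_all

lemma index_stack_vecs:
  assumes "set vs \<subseteq> carrier_vec d" and "i < length vs * d"
  shows "stack_vecs vs $ i = (vs ! (i div d)) $ (i mod d)"
  using assms
proof (induction vs arbitrary: i)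
  case (Cons v vs)
  \<comment> \<open>Block length 0 would leave no index below the total length.\<close>
  have d: "d > 0" using Cons.prems by (cases d) auto
  have dims: "dim_vec (stack_vecs vs) = length vs * d"
    using Cons.prems(1) by (induction vs) (auto simp: dim_stack_vecs)
  show ?case
  proof (cases "i < d")
    case True
    then show ?thesis using Cons.prems by (auto simp: dims)
  next
    case False
    then have "i div d = Suc ((i - d) div d)" "i mod d = (i - d) mod d"
      using d by (simp_all add: le_div_geq le_mod_geq)
    then show ?thesis using Cons.prems Cons.IH[of "i - d"] False dims by auto
  qed
qed simp

lemma zero_mat_mult_vec:
  fixes v :: "'a :: semiring_0 vec"
  assumes "dim_vec v = c"
  shows "0\<^sub>m r c *\<^sub>v v = 0\<^sub>v r"
  using assms by (intro eq_vecI) (auto simp: scalar_prod_def)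

text \<open>The blocks may be rectangular and of different sizes. Splitting off the first one leaves
  a two by two block matrix with zero off-diagonal parts.\<close>

lemma mult_diag_block_mat_stack_vecs:
  fixes f :: "'b \<Rightarrow> 'a :: comm_semiring_1 mat"
  assumes "\<And>x. x \<in> set xs \<Longrightarrow> dim_vec (g x) = dim_col (f x)"
  shows "diag_block_mat (map f xs) *\<^sub>v stack_vecs (map g xs) = stack_vecs (map (\<lambda>x. f x *\<^sub>v g x) xs)"
  using assms
proof (induction xs)
  case (Cons x xs)
  let ?D = "diag_block_mat (map f xs)"
  have D: "?D \<in> carrier_mat (dim_row ?D) (dim_col ?D)" by simp
  have "dim_vec (stack_vecs (map g xs)) = dim_col ?D"
    using Cons.prems by (auto simp: dim_diag_block_mat dim_stack_vecs o_def intro!: arg_cong[of _ _ sum_list])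
  then have g: "stack_vecs (map g xs) \<in> carrier_vec (dim_col ?D)" by (rule carrier_vecI)
  have fx: "f x \<in> carrier_mat (dim_row (f x)) (dim_col (f x))" by simp
  have gx: "g x \<in> carrier_vec (dim_col (f x))" using Cons.prems by (auto intro: carrier_vecI)
  have "stack_vecs (map (\<lambda>x. f x *\<^sub>v g x) xs) = ?D *\<^sub>v stack_vecs (map g xs)"
    using Cons by simp
  then have fg: "stack_vecs (map (\<lambda>x. f x *\<^sub>v g x) xs) \<in> carrier_vec (dim_row ?D)"
    by (simp add: carrier_vecI)
  have "f x *\<^sub>v g x \<in> carrier_vec (dim_row (f x))" by (simp add: carrier_vecI)
  with fg show ?case
    using four_block_mat_mult_vec[OF fx zero_carrier_mat zero_carrier_mat D gx g] Cons gx g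
    by (simp add: Let_def zero_mat_mult_vec)
qed auto

section \<open>Block rows and their vectorization\<close>

lemma dim_hcat [simp]:
  "dim_row (hcat r Ms) = r" "dim_col (hcat r Ms) = sum_list (map dim_col Ms)"
  by (simp_all add: hcat_def length_concat o_def)

lemma hcat_Cons:
  assumes "M \<in> carrier_mat r c"
  shows "hcat r (M # Ms) = mat r (c + dim_col (hcat r Ms))
    (\<lambda>(i, j). if j < c then M $$ (i, j) else hcat r Ms $$ (i, j - c))"
  using assms
  by (intro eq_matI) (auto simp: hcat_def mat_of_cols_index length_concat o_def nth_append)

text \<open>Peels off one block; iterated down to the empty list, this evaluates the rows of
  \<open>H1_block\<close>.\<close>

lemma hcat_Cons_mult_append_vec:
  fixes M :: "'a :: comm_semiring_1 mat"
  assumes "dim_row M = r" and "dim_vec v = dim_col M" and w: "dim_vec w = sum_list (map dim_col Ms)"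
  shows "hcat r (M # Ms) *\<^sub>v (v @\<^sub>v w) = M *\<^sub>v v + hcat r Ms *\<^sub>v w"
proof -
  let ?c = "dim_col M" and ?S = "hcat r Ms"
  have M: "M \<in> carrier_mat r ?c" using assms by auto
  show ?thesis
  proof (rule eq_vecI)
    fix i assume "i < dim_vec (M *\<^sub>v v + ?S *\<^sub>v w)"
    then have i: "i < r" by simp
    have "(hcat r (M # Ms) *\<^sub>v (v @\<^sub>v w)) $ i
        = (\<Sum>l<?c + dim_vec w. hcat r (M # Ms) $$ (i, l) * (v @\<^sub>v w) $ l)"
      using i assms by (simp add: hcat_Cons[OF M] scalar_prod_def lessThan_atLeast0)
    also have "\<dots> = (\<Sum>l<?c. M $$ (i, l) * v $ l) + (\<Sum>l<dim_vec w. ?S $$ (i, l) * w $ l)"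
      unfolding sum_lessThan_add using i assms by (simp add: hcat_Cons[OF M])
    also have "\<dots> = (M *\<^sub>v v + ?S *\<^sub>v w) $ i"
      using i assms by (simp add: scalar_prod_def lessThan_atLeast0)
    finally show "(hcat r (M # Ms) *\<^sub>v (v @\<^sub>v w)) $ i = (M *\<^sub>v v + ?S *\<^sub>v w) $ i" .
  qed (simp add: hcat_Cons[OF M])
qed

text \<open>Vectorization runs column by column and all blocks have \<open>r\<close> rows, so the
  first block fills the first r * c positions.\<close>

lemma vec_of_mat_hcat:
  assumes "set Ms \<subseteq> carrier_mat r c"
  shows "vec_of_mat (hcat r Ms) = stack_vecs (map vec_of_mat Ms)"
  using assms
proof (induction Ms)
  case Nil
  then show ?case by (auto simp: vec_of_mat_def hcat_def)
next
  case (Cons M Ms)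
  let ?S = "hcat r Ms"
  have M: "M \<in> carrier_mat r c" using Cons.prems by simp
  note H = hcat_Cons[OF M, of Ms]
  have rS: "dim_row ?S = r" by (simp add: hcat_def)
  have "vec_of_mat (hcat r (M # Ms)) = vec_of_mat M @\<^sub>v vec_of_mat ?S"
  proof (rule eq_vecI)
    show "dim_vec (vec_of_mat (hcat r (M # Ms))) = dim_vec (vec_of_mat M @\<^sub>v vec_of_mat ?S)"
      using M rS by (simp add: vec_of_mat_def H algebra_simps)
    fix i assume "i < dim_vec (vec_of_mat M @\<^sub>v vec_of_mat ?S)"
    then have i: "i < r * c + r * dim_col ?S" and r: "r > 0"
      using M rS by (auto simp: vec_of_mat_def intro: gr0I)
    have i': "i < r * (c + dim_col ?S)" using i by (simp add: algebra_simps)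
    have "i div r < c + dim_col ?S" using mod_div_lt_mult[OF i'] by simp
    moreover have "i div r < c \<longleftrightarrow> i < r * c" using r by (simp add: div_less_iff_less_mult mult.commute)
    \<comment> \<open>Dropping r * c positions lowers the column index by \<open>c\<close> and keeps
      the row index.\<close>
    moreover have "(i - r * c) mod r = i mod r" "(i - r * c) div r = i div r - c" if "r * c \<le> i"
      using that r
      by (metis mod_mult_self2 add.commute le_add_diff_inverse mult.commute,
        metis div_mult_self2 add.commute le_add_diff_inverse
          diff_add_inverse2 less_numeral_extra(3))
    ultimately show "vec_of_mat (hcat r (M # Ms)) $ i = (vec_of_mat M @\<^sub>v vec_of_mat ?S) $ i"
      using i i' r M rS by (auto simp: vec_of_mat_def H)
  qed
  then show ?case using Cons by simp
qed

section \<open>The linear system of the PGCS equation\<close>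

text \<open>A single index whose parity selects the family: the numbering of block rows and columns
  in \<open>pgcs_mat\<close>.\<close>

lemma concat_map_pair_upt:
  "concat (map (\<lambda>k. [f k, g k]) [0..<p]) = map (\<lambda>j. if even j then f (j div 2) else g (j div 2)) [0..<2 * p]"
  by (induction p) simp_all

lemma vec_of_mat_interleave:
  assumes "\<forall>k<p. P k \<in> carrier_mat m n \<and> Q k \<in> carrier_mat m n"
  shows "vec_of_mat (interleave p m P Q)
    = stack_vecs (concat (map (\<lambda>k. [vec_of_mat (P k), vec_of_mat (Q k)]) [0..<p]))"
proof -
  have "set (concat (map (\<lambda>k. [P k, Q k]) [0..<p])) \<subseteq> carrier_mat m n" using assms by auto
  then show ?thesis unfolding interleave_def
    by (simp add: vec_of_mat_hcat map_concat o_def)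
qed

text \<open>The flat form, matching the block columns of \<open>pgcs_mat\<close>; the paired form
  before it matches the diagonal blocks of \<open>H1\<close>.\<close>

lemma vec_of_mat_interleave_upt:
  assumes "\<forall>k<p. P k \<in> carrier_mat m n \<and> Q k \<in> carrier_mat m n"
  shows "vec_of_mat (interleave p m P Q)
    = stack_vecs (map (\<lambda>j. vec_of_mat (if even j then P (j div 2) else Q (j div 2))) [0..<2 * p])"
  unfolding vec_of_mat_interleave[OF assms] concat_map_pair_upt by (simp add: if_distrib)

lemma dim_vec_of_mat_interleave:
  assumes "\<forall>k<p. P k \<in> carrier_mat m n \<and> Q k \<in> carrier_mat m n"
  shows "dim_vec (vec_of_mat (interleave p m P Q)) = 2 * p * m * n"
proof -
  have "dim_vec (vec_of_mat (if even j then P (j div 2) else Q (j div 2))) = m * n" if "j < 2 * p" for j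
  proof -
    have "(if even j then P (j div 2) else Q (j div 2)) \<in> carrier_mat m n" using assms that by auto
    then show ?thesis by (simp add: index_vec_of_mat)
  qed
  then have "map (\<lambda>j. dim_vec (vec_of_mat (if even j then P (j div 2) else Q (j div 2)))) [0..<2 * p]
      = map (\<lambda>j. m * n) [0..<2 * p]" by (intro map_cong refl) simp
  then show ?thesis
    unfolding vec_of_mat_interleave_upt[OF assms] dim_stack_vecs map_map o_def
    by (simp only: sum_list_triv) simp
qed

lemma index_vec_of_mat_interleave:
  assumes PQ: "\<forall>k<p. P k \<in> carrier_mat m n \<and> Q k \<in> carrier_mat m n" and i: "i < 2 * p * m * n"
  shows "vec_of_mat (interleave p m P Q) $ i
    = vec_of_mat (if even (i div (m * n)) then P (i div (m * n) div 2) else Q (i div (m * n) div 2))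
        $ (i mod (m * n))"
proof -
  have i': "i < (m * n) * (2 * p)" using i by (simp add: mult_ac)
  have set: "set (map (\<lambda>j. vec_of_mat (if even j then P (j div 2) else Q (j div 2))) [0..<2 * p])
      \<subseteq> carrier_vec (m * n)"
    using PQ by auto
  show ?thesis
    unfolding vec_of_mat_interleave_upt[OF PQ]
    using index_stack_vecs[OF set, of i] i' mod_div_lt_mult[OF i'] by (simp add: mult.commute)
qed

lemma index_block_mat_mult_stack_vecs:
  fixes G :: "nat \<Rightarrow> nat \<Rightarrow> 'a :: comm_semiring_1 mat"
  assumes vs: "set vs \<subseteq> carrier_vec d" "length vs = s"
    and G: "\<And>i j. i < s \<Longrightarrow> j < s \<Longrightarrow> G i j \<in> carrier_mat d d"
    and i: "i < s * d"
  shows "(block_mat s d G *\<^sub>v stack_vecs vs) $ i = (\<Sum>j<s. (G (i div d) j *\<^sub>v vs ! j) $ (i mod d))"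
proof -
  have dims: "dim_vec (stack_vecs vs) = s * d"
    using vs(1) unfolding vs(2)[symmetric] by (induction vs) (auto simp: dim_stack_vecs)
  note ir = mod_div_lt_mult[of i d s, OF i[unfolded mult.commute[of s]]]
  have "(block_mat s d G *\<^sub>v stack_vecs vs) $ i
      = (\<Sum>l<s * d. G (i div d) (l div d) $$ (i mod d, l mod d) * stack_vecs vs $ l)"
    using i dims by (auto simp: block_mat_def scalar_prod_def lessThan_atLeast0 intro!: sum.cong)
  also have "\<dots> = (\<Sum>l<s * d. G (i div d) (l div d) $$ (i mod d, l mod d) * (vs ! (l div d) $ (l mod d)))"
    using vs by (intro sum.cong refl) (simp add: index_stack_vecs)
  also have "\<dots> = (\<Sum>j<s. \<Sum>k<d. G (i div d) j $$ (i mod d, k) * (vs ! j $ k))"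
    unfolding sum_lessThan_mult by (intro sum.cong refl) simp
  also have "\<dots> = (\<Sum>j<s. (G (i div d) j *\<^sub>v vs ! j) $ (i mod d))"
  proof (intro sum.cong refl)
    fix j assume "j \<in> {..<s}"
    then have "vs ! j \<in> carrier_vec d" "G (i div d) j \<in> carrier_mat d d"
      using vs ir G by (auto dest: nth_mem)
    then show "(\<Sum>k<d. G (i div d) j $$ (i mod d, k) * (vs ! j $ k)) = (G (i div d) j *\<^sub>v vs ! j) $ (i mod d)"
      using ir by (simp add: scalar_prod_def lessThan_atLeast0)
  qed
  finally show ?thesis .
qed

lemma pgcs_mat_carrier [simp]: "pgcs_mat p m n A B C D \<in> carrier_mat (2 * p * m * n) (2 * p * m * n)"
  unfolding pgcs_mat_def block_mat_def by (simp add: mult_ac)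

text \<open>Each block row has only two nonzero blocks, which the Kronecker identities turn into the
  two products of its equation.\<close>

lemma pgcs_mat_mult_vec:
  assumes AC: "\<forall>k<p. A k \<in> carrier_mat m m \<and> C k \<in> carrier_mat m m"
    and BD: "\<forall>k<p. B k \<in> carrier_mat n n \<and> D k \<in> carrier_mat n n"
    and XY: "\<forall>k<p. X k \<in> carrier_mat m n \<and> Y k \<in> carrier_mat m n"
  shows "pgcs_mat p m n A B C D *\<^sub>v vec_of_mat (interleave p m X Y)
    = vec_of_mat (interleave p m (\<lambda>k. A k * X k - Y k * B k) (\<lambda>k. C k * X (Suc k mod p) - Y k * D k))"
    (is "?W *\<^sub>v _ = vec_of_mat (interleave p m ?P ?Q)")
proof (rule eq_vecI)
  let ?d = "m * n"
  have PQ: "\<forall>k<p. ?P k \<in> carrier_mat m n \<and> ?Q k \<in> carrier_mat m n"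
    using AC BD XY by (fastforce intro!: minus_carrier_mat)
  show "dim_vec (?W *\<^sub>v vec_of_mat (interleave p m X Y)) = dim_vec (vec_of_mat (interleave p m ?P ?Q))"
    using carrier_matD(1)[OF pgcs_mat_carrier] by (simp add: dim_vec_of_mat_interleave[OF PQ])
  fix i assume "i < dim_vec (vec_of_mat (interleave p m ?P ?Q))"
  then have i: "i < 2 * p * m * n" unfolding dim_vec_of_mat_interleave[OF PQ] .
  then have i': "i < ?d * (2 * p)" by (simp add: mult_ac)
  define b r k where "b = i div ?d" and "r = i mod ?d" and "k = b div 2"
  have b: "b < 2 * p" and r: "r < ?d" using mod_div_lt_mult[OF i'] by (auto simp: b_def r_def)
  then have k: "k < p" and k': "Suc k mod p < p" by (auto simp: k_def)
  define vs where "vs = map (\<lambda>j. vec_of_mat (if even j then X (j div 2) else Y (j div 2))) [0..<2 * p]"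
  \<comment> \<open>The block function inside \<open>pgcs_mat\<close>, named so that it can be
    folded.\<close>
  define G where "G = (\<lambda>i j. let k = i div 2 in
     if even i then
       if j = 2 * k then kronecker (1\<^sub>m n) (A k)
       else if j = 2 * k + 1 then - kronecker (transpose_mat (B k)) (1\<^sub>m m)
       else 0\<^sub>m ?d ?d
     else
       if j = 2 * k + 1 then - kronecker (transpose_mat (D k)) (1\<^sub>m m)
       else if j = 2 * (Suc k mod p) then kronecker (1\<^sub>m n) (C k)
       else 0\<^sub>m ?d ?d)"
  have car: "kronecker (1\<^sub>m n) M \<in> carrier_mat ?d ?d" if "M \<in> carrier_mat m m" for M :: "real mat"
    using that by (intro carrier_matI) (simp_all add: carrier_matD[OF that] mult.commute)
  have cat: "kronecker (transpose_mat N) (1\<^sub>m m) \<in> carrier_mat ?d ?d" if "N \<in> carrier_mat n n" for N :: "real mat"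
    using that by (intro carrier_matI) (simp_all add: carrier_matD[OF that] mult.commute)
  have G: "G i j \<in> carrier_mat ?d ?d" if "i < 2 * p" "j < 2 * p" for i j
  proof -
    have "i div 2 < p" using that by auto
    then show ?thesis using AC BD unfolding G_def by (simp add: Let_def car cat)
  qed
  have vs: "set vs \<subseteq> carrier_vec ?d" "length vs = 2 * p"
    using XY unfolding vs_def by auto
  have vsX: "vs ! (2 * l) = vec_of_mat (X l)" and vsY: "vs ! (Suc (2 * l)) = vec_of_mat (Y l)" if "l < p" for l
    using that by (auto simp: vs_def)
  have z: "(0\<^sub>m ?d ?d *\<^sub>v vs ! j) $ r = 0" if "j < 2 * p" for j
  proof -
    have "vs ! j \<in> carrier_vec ?d" using that vs nth_mem[of j vs] by auto
    then show ?thesis using r by (simp add: zero_mat_mult_vec)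
  qed
  have kA: "kronecker (1\<^sub>m n) M *\<^sub>v vec_of_mat (X l) = vec_of_mat (M * X l)"
    if "M \<in> carrier_mat m m" "l < p" for l M using that XY by (intro kronecker_one_mult_vec) auto
  have kB: "(- kronecker (transpose_mat M) (1\<^sub>m m) *\<^sub>v vec_of_mat (Y l)) $ r = - (vec_of_mat (Y l * M) $ r)"
    if "M \<in> carrier_mat n n" "l < p" for l M
  proof -
    have Yl: "Y l \<in> carrier_mat m n" using XY that by auto
    have "vec_of_mat (Y l) \<in> carrier_vec ?d" using Yl by simp
    then have "dim_vec (vec_of_mat (Y l)) = dim_col (kronecker (transpose_mat M) (1\<^sub>m m))"
      using that by (simp add: mult.commute)
    moreover have "Y l * M \<in> carrier_mat m n" using Yl that by simp
    then have "dim_vec (vec_of_mat (Y l * M)) = ?d" by (rule index_vec_of_mat(2))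
    ultimately show ?thesis
      using r kronecker_transpose_one_mult_vec[OF Yl that(1)] by simp
  qed
  have entry: "vec_of_mat (S - T) $ r = vec_of_mat S $ r - vec_of_mat T $ r"
    if "S \<in> carrier_mat m n" "T \<in> carrier_mat m n" for S T
    using that r mod_div_lt_mult[OF r] index_vec_of_mat(1)[OF minus_carrier_mat[OF that(2)], of r S]
    by (simp add: index_vec_of_mat)
  have "(?W *\<^sub>v vec_of_mat (interleave p m X Y)) $ i = (\<Sum>j<2 * p. (G b j *\<^sub>v vs ! j) $ r)"
    unfolding vec_of_mat_interleave_upt[OF XY] pgcs_mat_def b_def r_def vs_def[symmetric] G_def[symmetric]
    using i' by (intro index_block_mat_mult_stack_vecs vs G) (auto simp: mult.commute)
  also have "\<dots> = vec_of_mat (if even b then ?P k else ?Q k) $ r"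
  proof (cases "even b")
    case True
    have "(\<Sum>j<2 * p. (G b j *\<^sub>v vs ! j) $ r) = (\<Sum>j\<in>{2 * k, Suc (2 * k)}. (G b j *\<^sub>v vs ! j) $ r)"
      using k k' r z True
      by (intro sum.mono_neutral_right) (auto simp: G_def k_def[symmetric] Let_def)
    also have "\<dots> = (G b (2 * k) *\<^sub>v vs ! (2 * k)) $ r + (G b (Suc (2 * k)) *\<^sub>v vs ! Suc (2 * k)) $ r"
      by simp
    also have "\<dots> = vec_of_mat (A k * X k) $ r - vec_of_mat (Y k * B k) $ r"
      using True k AC BD unfolding vsX[OF k] vsY[OF k] by (simp add: G_def Let_def k_def[symmetric] kA kB)
    also have "\<dots> = vec_of_mat (?P k) $ r"
      using k AC BD XY by (intro entry[symmetric]) auto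
    finally show ?thesis using True by simp
  next
    case False
    have "(\<Sum>j<2 * p. (G b j *\<^sub>v vs ! j) $ r) = (\<Sum>j\<in>{2 * (Suc k mod p), Suc (2 * k)}. (G b j *\<^sub>v vs ! j) $ r)"
      using k k' r z False
      by (intro sum.mono_neutral_right) (auto simp: G_def k_def[symmetric] Let_def)
    also have "\<dots> = (G b (2 * (Suc k mod p)) *\<^sub>v vs ! (2 * (Suc k mod p))) $ r
        + (G b (Suc (2 * k)) *\<^sub>v vs ! Suc (2 * k)) $ r"
    proof -
      \<comment> \<open>Columns of an X are even and those of a Y odd, so the two never collide, not
        even for p = 1, where the cyclic successor of k is k.\<close>
      have "2 * (Suc k mod p) \<noteq> Suc (2 * k)" by (rule double_not_eq_Suc_double)
      then show ?thesis by simp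
    qed
    also have "\<dots> = vec_of_mat (C k * X (Suc k mod p)) $ r - vec_of_mat (Y k * D k) $ r"
    proof -
      have "2 * (Suc k mod p) \<noteq> Suc (2 * k)" by (rule double_not_eq_Suc_double)
      then show ?thesis
        using False k k' AC BD unfolding vsX[OF k'] vsY[OF k]
        by (simp add: G_def Let_def k_def[symmetric] kA kB)
    qed
    also have "\<dots> = vec_of_mat (?Q k) $ r"
      using k k' AC BD XY by (intro entry[symmetric]) auto
    finally show ?thesis using False by simp
  qed
  also have "\<dots> = vec_of_mat (interleave p m ?P ?Q) $ i"
    unfolding b_def r_def k_def by (rule index_vec_of_mat_interleave[OF PQ i, symmetric])
  finally show "(?W *\<^sub>v vec_of_mat (interleave p m X Y)) $ i = vec_of_mat (interleave p m ?P ?Q) $ i" .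
qed

section \<open>The product of \<open>H1\<close> and \<open>u\<close>, in which the tolerances
  cancel\<close>

lemma smult_mat_mult_inverse_smult_vec:
  fixes K :: "real mat"
  assumes "a \<noteq> 0" "dim_vec v = dim_col K"
  shows "(a \<cdot>\<^sub>m K) *\<^sub>v ((1 / a) \<cdot>\<^sub>v v) = K *\<^sub>v v"
  using assms by (intro eq_vecI) (auto simp: scalar_prod_def)

lemma vec_of_mat_minus:
  assumes "P \<in> carrier_mat r c" "Q \<in> carrier_mat r c"
  shows "vec_of_mat (P - Q :: 'a :: minus mat) = vec_of_mat P - vec_of_mat Q"
  using assms by (intro eq_vecI) (auto simp: vec_of_mat_def mod_div_lt_mult)

text \<open>\<open>P\<close>, \<open>Q\<close>, \<open>R\<close> and their primed versions are the
  perturbations. Of the six blocks in each half, three vanish and three lose their weight against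
  its reciprocal in the vector.\<close>

lemma H1_block_mult_vec:
  assumes X: "X \<in> carrier_mat m n" "X' \<in> carrier_mat m n" and Y: "Y \<in> carrier_mat m n"
    and P: "P \<in> carrier_mat m m" and Q: "Q \<in> carrier_mat n n" and R: "R \<in> carrier_mat m n"
    and P': "P' \<in> carrier_mat m m" and Q': "Q' \<in> carrier_mat n n" and R': "R' \<in> carrier_mat m n"
    and nz: "\<alpha> \<noteq> 0" "\<beta> \<noteq> 0" "\<gamma> \<noteq> 0" "\<zeta> \<noteq> 0" "\<tau> \<noteq> 0" "\<delta> \<noteq> 0"
  shows "H1_block m n \<alpha> \<beta> \<gamma> \<zeta> \<tau> \<delta> X X' Y *\<^sub>v stack_vecs
      [(1 / \<alpha>) \<cdot>\<^sub>v vec_of_mat P, (1 / \<beta>) \<cdot>\<^sub>v vec_of_mat Q, (1 / \<gamma>) \<cdot>\<^sub>v vec_of_mat R,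
       (1 / \<zeta>) \<cdot>\<^sub>v vec_of_mat P', (1 / \<tau>) \<cdot>\<^sub>v vec_of_mat Q', (1 / \<delta>) \<cdot>\<^sub>v vec_of_mat R']
    = vec_of_mat (P * X - Y * Q - R) @\<^sub>v vec_of_mat (P' * X' - Y * Q' - R')"
    (is "?H *\<^sub>v ?u = _")
proof -
  let ?d = "m * n" and ?K = "kronecker (1\<^sub>m n) Y"
  let ?J = "kronecker (transpose_mat X) (1\<^sub>m m)" and ?J' = "kronecker (transpose_mat X') (1\<^sub>m m)"
  have dims: "dim_row ?J = ?d" "dim_col ?J = m * m" "dim_row ?J' = ?d" "dim_col ?J' = m * m"
    "dim_row ?K = ?d" "dim_col ?K = n * n"
    using X Y by simp_all
  note mults = kronecker_transpose_one_mult_vec[OF P X(1)] kronecker_transpose_one_mult_vec[OF P' X(2)]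
    kronecker_one_mult_vec[OF Y Q] kronecker_one_mult_vec[OF Y Q']
  note dv = index_vec_of_mat(2)[OF P] index_vec_of_mat(2)[OF Q] index_vec_of_mat(2)[OF R]
    index_vec_of_mat(2)[OF P'] index_vec_of_mat(2)[OF Q'] index_vec_of_mat(2)[OF R']
  have one: "1\<^sub>m ?d *\<^sub>v vec_of_mat S = vec_of_mat S" if "S \<in> carrier_mat m n" for S :: "real mat"
    using that by (intro one_mult_mat_vec) simp
  \<comment> \<open>End of the peeling: a block row without columns times the empty vector.\<close>
  have nil: "hcat ?d [] *\<^sub>v vNil = 0\<^sub>v ?d" by (intro eq_vecI) (auto simp: scalar_prod_def)
  have minus: "vec_of_mat (S * T - T' * S' - S'') = vec_of_mat (S * T) - vec_of_mat (T' * S') - vec_of_mat S''"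
    if "S * T \<in> carrier_mat m n" "T' * S' \<in> carrier_mat m n" "S'' \<in> carrier_mat m n"
    for S T S' T' S'' :: "real mat"
    using that by (simp add: vec_of_mat_minus[of _ m n] minus_carrier_mat)
  have PX: "P * X \<in> carrier_mat m n" "P' * X' \<in> carrier_mat m n"
    and YQ: "Y * Q \<in> carrier_mat m n" "Y * Q' \<in> carrier_mat m n"
    using X Y P P' Q Q' by simp_all
  note dv2 = index_vec_of_mat(2)[OF PX(1)] index_vec_of_mat(2)[OF PX(2)]
    index_vec_of_mat(2)[OF YQ(1)] index_vec_of_mat(2)[OF YQ(2)]
  define H where "H = hcat ?d [\<alpha> \<cdot>\<^sub>m ?J, - (\<beta> \<cdot>\<^sub>m ?K), - (\<gamma> \<cdot>\<^sub>m 1\<^sub>m ?d),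
    0\<^sub>m ?d (m * m), 0\<^sub>m ?d (n * n), 0\<^sub>m ?d ?d]"
  define H' where "H' = hcat ?d [0\<^sub>m ?d (m * m), 0\<^sub>m ?d (n * n), 0\<^sub>m ?d ?d,
    \<zeta> \<cdot>\<^sub>m ?J', - (\<tau> \<cdot>\<^sub>m ?K), - (\<delta> \<cdot>\<^sub>m 1\<^sub>m ?d)]"
  note sim = hcat_Cons_mult_append_vec dims dv zero_mat_mult_vec nil uminus_mult_mat_vec
        smult_mat_mult_inverse_smult_vec nz mults one R R'
  \<comment> \<open>The right-nested sum with trailing zeros is the shape that the peeling
    leaves.\<close>
  have "H *\<^sub>v ?u = vec_of_mat (P * X) + (- vec_of_mat (Y * Q) + (- vec_of_mat R
      + (0\<^sub>v ?d + (0\<^sub>v ?d + (0\<^sub>v ?d + 0\<^sub>v ?d)))))"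
    unfolding H_def by (simp add: sim del: dim_kronecker)
  also have "\<dots> = vec_of_mat (P * X - Y * Q - R)"
    unfolding minus[OF PX(1) YQ(1) R] by (intro eq_vecI) (simp_all add: dv dv2)
  finally have Hu: "H *\<^sub>v ?u = vec_of_mat (P * X - Y * Q - R)" .
  have "H' *\<^sub>v ?u = 0\<^sub>v ?d + (0\<^sub>v ?d + (0\<^sub>v ?d + (vec_of_mat (P' * X')
      + (- vec_of_mat (Y * Q') + (- vec_of_mat R' + 0\<^sub>v ?d)))))"
    unfolding H'_def by (simp add: sim del: dim_kronecker)
  also have "\<dots> = vec_of_mat (P' * X' - Y * Q' - R')"
    unfolding minus[OF PX(2) YQ(2) R'] by (intro eq_vecI) (simp_all add: dv dv2)
  finally have H'u: "H' *\<^sub>v ?u = vec_of_mat (P' * X' - Y * Q' - R')" .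
  have du: "dim_vec ?u = m * m + n * n + m * n + m * m + n * n + m * n" by (simp add: dv)
  have carr: "H \<in> carrier_mat ?d (dim_vec ?u)" "H' \<in> carrier_mat ?d (dim_vec ?u)"
    unfolding H_def H'_def du
    by (rule carrier_matI; simp add: dims del: dim_kronecker)+
  show ?thesis
    unfolding H1_block_def H_def[symmetric] H'_def[symmetric] Hu[symmetric] H'u[symmetric]
    by (rule mat_mult_append[OF carr carrier_vec_dim_vec])
qed

text \<open>\<open>A\<close> to \<open>F\<close> stand for the perturbations here. If
  \<open>X\<close>, \<open>Y\<close> solve the unperturbed equation, the right-hand side is the
  residual they leave in the perturbed one.\<close>

lemma H1_mult_vec:
  assumes XY: "\<forall>k<p. X k \<in> carrier_mat m n \<and> Y k \<in> carrier_mat m n"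
    and AC: "\<forall>k<p. A k \<in> carrier_mat m m \<and> C k \<in> carrier_mat m m"
    and BD: "\<forall>k<p. B k \<in> carrier_mat n n \<and> D k \<in> carrier_mat n n"
    and EF: "\<forall>k<p. E k \<in> carrier_mat m n \<and> F k \<in> carrier_mat m n"
    and pos: "\<forall>k<p. \<alpha> k > 0 \<and> \<beta> k > 0 \<and> \<gamma> k > 0 \<and> \<zeta> k > 0 \<and> \<tau> k > 0 \<and> \<delta> k > 0"
  shows "H1 p m n \<alpha> \<beta> \<gamma> \<zeta> \<tau> \<delta> X Y *\<^sub>v scaled_perturbation p \<alpha> \<beta> \<gamma> \<zeta> \<tau> \<delta> A B C D E F
    = vec_of_mat (interleave p m (\<lambda>k. A k * X k - Y k * B k - E k)
        (\<lambda>k. C k * X (Suc k mod p) - Y k * D k - F k))"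
    (is "_ = vec_of_mat (interleave p m ?P ?Q)")
proof -
  \<comment> \<open>A difference of matrices takes its dimensions from the subtrahend, here
    \<open>E k\<close> or \<open>F k\<close>.\<close>
  have PQ: "\<forall>k<p. ?P k \<in> carrier_mat m n \<and> ?Q k \<in> carrier_mat m n"
    using EF by (auto intro!: minus_carrier_mat)
  define f where "f = (\<lambda>k. H1_block m n (\<alpha> k) (\<beta> k) (\<gamma> k) (\<zeta> k) (\<tau> k) (\<delta> k) (X k) (X (Suc k mod p)) (Y k))"
  define g where "g = (\<lambda>k. stack_vecs
     [(1 / \<alpha> k) \<cdot>\<^sub>v vec_of_mat (A k), (1 / \<beta> k) \<cdot>\<^sub>v vec_of_mat (B k),
      (1 / \<gamma> k) \<cdot>\<^sub>v vec_of_mat (E k), (1 / \<zeta> k) \<cdot>\<^sub>v vec_of_mat (C k),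
      (1 / \<tau> k) \<cdot>\<^sub>v vec_of_mat (D k), (1 / \<delta> k) \<cdot>\<^sub>v vec_of_mat (F k)])"
  have fg: "f k *\<^sub>v g k = stack_vecs [vec_of_mat (?P k), vec_of_mat (?Q k)]" if "k < p" for k
  proof -
    have "Suc k mod p < p" using that by simp
    then have "f k *\<^sub>v g k = vec_of_mat (?P k) @\<^sub>v vec_of_mat (?Q k)"
      unfolding f_def g_def using that XY AC BD EF pos by (intro H1_block_mult_vec) (auto dest: less_imp_neq)
    moreover have "vec_of_mat (?Q k) @\<^sub>v vNil = vec_of_mat (?Q k)" by (intro eq_vecI) auto
    ultimately show ?thesis by simp
  qed
  have dims: "dim_vec (g k) = dim_col (f k)" if "k \<in> set [0..<p]" for k
  proof -
    have car: "A k \<in> carrier_mat m m" "C k \<in> carrier_mat m m" "B k \<in> carrier_mat n n" "D k \<in> carrier_mat n n"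
      "E k \<in> carrier_mat m n" "F k \<in> carrier_mat m n" "X k \<in> carrier_mat m n" "Y k \<in> carrier_mat m n"
      using that XY AC BD EF by auto
    then show ?thesis unfolding f_def g_def H1_block_def
      by (simp add: append_rows_def car(1-6)[THEN index_vec_of_mat(2)])
  qed
  have "scaled_perturbation p \<alpha> \<beta> \<gamma> \<zeta> \<tau> \<delta> A B C D E F = stack_vecs (map g [0..<p])"
    unfolding scaled_perturbation_def stack_vecs_concat map_map o_def g_def ..
  then have "H1 p m n \<alpha> \<beta> \<gamma> \<zeta> \<tau> \<delta> X Y *\<^sub>v scaled_perturbation p \<alpha> \<beta> \<gamma> \<zeta> \<tau> \<delta> A B C D E F
      = stack_vecs (map (\<lambda>k. f k *\<^sub>v g k) [0..<p])"
    using mult_diag_block_mat_stack_vecs[of "[0..<p]" g f, OF dims] unfolding H1_def f_def by simp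
  also have "\<dots> = vec_of_mat (interleave p m ?P ?Q)"
    unfolding vec_of_mat_interleave[OF PQ] stack_vecs_concat map_map o_def
    using fg by (intro arg_cong[of _ _ stack_vecs] map_cong) simp_all
  finally show ?thesis .
qed

section \<open>Stacking is injective, onto and additive\<close>

lemma vec_of_mat_interleave_inject:
  assumes PQ: "\<forall>k<p. P k \<in> carrier_mat m n \<and> Q k \<in> carrier_mat m n"
    and PQ': "\<forall>k<p. P' k \<in> carrier_mat m n \<and> Q' k \<in> carrier_mat m n"
  shows "vec_of_mat (interleave p m P Q) = vec_of_mat (interleave p m P' Q')
    \<longleftrightarrow> (\<forall>k<p. P k = P' k \<and> Q k = Q' k)"
proof
  assume eq: "vec_of_mat (interleave p m P Q) = vec_of_mat (interleave p m P' Q')"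
  have entry: "(if even b then P (b div 2) else Q (b div 2)) = (if even b then P' (b div 2) else Q' (b div 2))"
    (is "?M = ?M'") if b: "b < 2 * p" for b
  proof -
    have "b div 2 < p" using b by simp
    then have M: "?M \<in> carrier_mat m n" and M': "?M' \<in> carrier_mat m n" using PQ PQ' by auto
    show ?thesis
    proof (rule eq_matI)
      fix i j assume "i < dim_row ?M'" "j < dim_col ?M'"
      then have ij: "i < m" "j < n" using carrier_matD[OF M'] by simp_all
      \<comment> \<open>Entry (i, j) of block \<open>b\<close> sits at position b * (m * n) + j * m
        + i of the stacked vector.\<close>
      define r where "r = j * m + i"
      have "j * m + i < Suc j * m" using ij by simp
      also have "\<dots> \<le> n * m" using ij by (intro mult_le_mono1) simp
      finally have r: "r < m * n" by (simp add: r_def mult.commute)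
      have rij: "r mod m = i" "r div m = j" using ij by (simp_all add: r_def)
      have "b * (m * n) + r < Suc b * (m * n)" using r by simp
      also have "\<dots> \<le> 2 * p * (m * n)" using b by (intro mult_le_mono1) simp
      finally have l: "b * (m * n) + r < 2 * p * m * n" by (simp add: mult.assoc)
      have "(b * d + r) div d = b \<and> (b * d + r) mod d = r" if "r < d" for d using that by auto
      from this[OF r] have bd: "(b * (m * n) + r) div (m * n) = b" "(b * (m * n) + r) mod (m * n) = r"
        by simp_all
      have "vec_of_mat ?M $ r = vec_of_mat ?M' $ r"
        using index_vec_of_mat_interleave[OF PQ l] index_vec_of_mat_interleave[OF PQ' l] eq
        unfolding bd by simp
      then show "?M $$ (i, j) = ?M' $$ (i, j)"
        unfolding index_vec_of_mat(1)[OF M r] index_vec_of_mat(1)[OF M' r] rij .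
    qed (use carrier_matD[OF M] carrier_matD[OF M'] in simp_all)
  qed
  show "\<forall>k<p. P k = P' k \<and> Q k = Q' k"
  proof (intro allI impI)
    fix k assume "k < p"
    then show "P k = P' k \<and> Q k = Q' k" using entry[of "2 * k"] entry[of "Suc (2 * k)"] by simp
  qed
next
  assume "\<forall>k<p. P k = P' k \<and> Q k = Q' k"
  then show "vec_of_mat (interleave p m P Q) = vec_of_mat (interleave p m P' Q')"
    unfolding interleave_def by (metis (no_types, lifting) atLeastLessThan_upt atLeastLessThan_iff map_cong set_upt)
qed

text \<open>The families come out extensional, ready to witness the existence claim of the
  theorem.\<close>

lemma vec_of_mat_interleave_surj:
  assumes v: "v \<in> carrier_vec (2 * p * m * n)"
  obtains P Q where "P \<in> {..<p} \<rightarrow>\<^sub>E carrier_mat m n" "Q \<in> {..<p} \<rightarrow>\<^sub>E carrier_mat m n"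
    "vec_of_mat (interleave p m P Q) = v"
proof -
  \<comment> \<open>Folds the piece number \<open>b\<close>, of length m * n, column by column into
    a matrix.\<close>
  let ?M = "\<lambda>b. mat m n (\<lambda>(i, j). v $ (b * (m * n) + j * m + i))"
  define P where "P = restrict (\<lambda>k. ?M (2 * k)) {..<p}"
  define Q where "Q = restrict (\<lambda>k. ?M (Suc (2 * k))) {..<p}"
  have P: "P \<in> {..<p} \<rightarrow>\<^sub>E carrier_mat m n" and Q: "Q \<in> {..<p} \<rightarrow>\<^sub>E carrier_mat m n"
    unfolding P_def Q_def by auto
  have PQ: "\<forall>k<p. P k \<in> carrier_mat m n \<and> Q k \<in> carrier_mat m n" using P Q by auto
  have "vec_of_mat (interleave p m P Q) = v"
  proof (rule eq_vecI)
    fix i assume "i < dim_vec v"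
    then have i: "i < 2 * p * m * n" using v by simp
    then have i': "i < (m * n) * (2 * p)" by (simp add: mult_ac)
    define b r where "b = i div (m * n)" and "r = i mod (m * n)"
    have b: "b < 2 * p" and r: "r < m * n" using mod_div_lt_mult[OF i'] by (auto simp: b_def r_def)
    have "(if even b then P (b div 2) else Q (b div 2)) = ?M b"
      using b by (auto simp: P_def Q_def elim!: evenE oddE)
    then have "vec_of_mat (interleave p m P Q) $ i = vec_of_mat (?M b) $ r"
      using index_vec_of_mat_interleave[OF PQ i] unfolding b_def[symmetric] r_def[symmetric] by simp
    also have "\<dots> = v $ (b * (m * n) + (r div m * m + r mod m))"
      using mod_div_lt_mult[OF r] r by (simp add: index_vec_of_mat[of _ m n] add.assoc)
    also have "\<dots> = v $ i" unfolding div_mult_mod_eq b_def r_def ..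
    finally show "vec_of_mat (interleave p m P Q) $ i = v $ i" .
  qed (use v dim_vec_of_mat_interleave[OF PQ] in auto)
  then show ?thesis using that P Q by blast
qed

lemma vec_of_mat_interleave_add:
  assumes PQ: "\<forall>k<p. P k \<in> carrier_mat m n \<and> Q k \<in> carrier_mat m n"
    and PQ': "\<forall>k<p. P' k \<in> carrier_mat m n \<and> Q' k \<in> carrier_mat m n"
  shows "vec_of_mat (interleave p m (\<lambda>k. P k + P' k) (\<lambda>k. Q k + Q' k))
    = vec_of_mat (interleave p m P Q) + vec_of_mat (interleave p m P' Q')"
proof (rule eq_vecI)
  have S: "\<forall>k<p. P k + P' k \<in> carrier_mat m n \<and> Q k + Q' k \<in> carrier_mat m n" using PQ PQ' by auto
  note dims = dim_vec_of_mat_interleave[OF S] dim_vec_of_mat_interleave[OF PQ] dim_vec_of_mat_interleave[OF PQ']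
  show "dim_vec (vec_of_mat (interleave p m (\<lambda>k. P k + P' k) (\<lambda>k. Q k + Q' k)))
    = dim_vec (vec_of_mat (interleave p m P Q) + vec_of_mat (interleave p m P' Q'))"
    using dims by simp
  fix i assume "i < dim_vec (vec_of_mat (interleave p m P Q) + vec_of_mat (interleave p m P' Q'))"
  then have i: "i < 2 * p * m * n" using dims by simp
  then have i': "i < (m * n) * (2 * p)" by (simp add: mult_ac)
  note r = mod_div_lt_mult[OF i']
  then have k: "i div (m * n) div 2 < p" by simp
  have sum: "vec_of_mat (S + T) $ (i mod (m * n)) = vec_of_mat S $ (i mod (m * n)) + vec_of_mat T $ (i mod (m * n))"
    if "S \<in> carrier_mat m n" "T \<in> carrier_mat m n" for S T :: "real mat"
    using that r(1) mod_div_lt_mult[OF r(1)] by (simp add: index_vec_of_mat(1)[of _ m n])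
  show "vec_of_mat (interleave p m (\<lambda>k. P k + P' k) (\<lambda>k. Q k + Q' k)) $ i
    = (vec_of_mat (interleave p m P Q) + vec_of_mat (interleave p m P' Q')) $ i"
    using i k PQ PQ' dims
    by (simp add: index_vec_of_mat_interleave[OF S] index_vec_of_mat_interleave[OF PQ]
        index_vec_of_mat_interleave[OF PQ'] sum)
qed

section \<open>The perturbed equation\<close>

text \<open>In each entry this is real arithmetic. The grouping on the right is the point: its three
  summands become the contributions of W, \<Delta>W and \<open>H1 u\<close>.\<close>

lemma mat_sum_diff_eq_iff:
  fixes P1 P2 P3 P4 Q1 Q2 Q3 Q4 E :: "real mat"
  assumes "P1 \<in> carrier_mat m n" "P2 \<in> carrier_mat m n" "P3 \<in> carrier_mat m n" "P4 \<in> carrier_mat m n"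
    "Q1 \<in> carrier_mat m n" "Q2 \<in> carrier_mat m n" "Q3 \<in> carrier_mat m n" "Q4 \<in> carrier_mat m n"
    "E \<in> carrier_mat m n"
  shows "(P1 + P2) + (P3 + P4) - ((Q1 + Q2) + (Q3 + Q4)) = (P1 - Q1) + E
    \<longleftrightarrow> (P3 - Q2) + (P4 - Q4) + (P2 - Q3 - E) = 0\<^sub>m m n"
    (is "?L = ?R \<longleftrightarrow> ?S = _")
proof -
  have "?L $$ (i, j) = ?R $$ (i, j) \<longleftrightarrow> ?S $$ (i, j) = 0" if "i < m" "j < n" for i j
    using that assms by auto
  moreover have "dim_row ?L = m" "dim_col ?L = n" "dim_row ?R = m" "dim_col ?R = n"
    "dim_row ?S = m" "dim_col ?S = n"
    using assms by simp_all
  ultimately show ?thesis unfolding mat_eq_iff by simp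
qed

text \<open>Expanding the products and inserting A X - Y B for \<open>E\<close> cancels the
  unperturbed part. The second equation uses it with C, D and X at the successor index.\<close>

lemma perturbed_equation_iff:
  fixes A B X Y A' B' X' Y' E E' :: "real mat"
  assumes A: "A \<in> carrier_mat m m" "A' \<in> carrier_mat m m" and B: "B \<in> carrier_mat n n" "B' \<in> carrier_mat n n"
    and X: "X \<in> carrier_mat m n" "X' \<in> carrier_mat m n" and Y: "Y \<in> carrier_mat m n" "Y' \<in> carrier_mat m n"
    and E: "E' \<in> carrier_mat m n" and eq: "A * X - Y * B = E"
  shows "(A + A') * (X + X') - (Y + Y') * (B + B') = E + E' \<longleftrightarrow>
    (A * X' - Y' * B) + (A' * X' - Y' * B') + (A' * X - Y * B' - E') = 0\<^sub>m m n"
proof -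
  have L: "(A + A') * (X + X') = (A * X + A' * X) + (A * X' + A' * X')"
    using A X by (simp add: add_mult_distrib_mat[of _ m m] mult_add_distrib_mat[of _ m m])
  have R: "(Y + Y') * (B + B') = (Y * B + Y' * B) + (Y * B' + Y' * B')"
    using B Y by (simp add: add_mult_distrib_mat[of _ m n] mult_add_distrib_mat[of _ m n])
  show ?thesis unfolding L R eq[symmetric]
    using A B X Y E by (intro mat_sum_diff_eq_iff) simp_all
qed

text \<open>Each of the three terms is a stacked family; additivity merges them, and injectivity of
  stacking splits the vector equation into the matrix equations.\<close>

lemma pgcs_perturbed_iff:
  assumes AC: "\<forall>k<p. A k \<in> carrier_mat m m \<and> C k \<in> carrier_mat m m"
    and BD: "\<forall>k<p. B k \<in> carrier_mat n n \<and> D k \<in> carrier_mat n n"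
    and XY: "\<forall>k<p. X k \<in> carrier_mat m n \<and> Y k \<in> carrier_mat m n"
    and AC': "\<forall>k<p. A' k \<in> carrier_mat m m \<and> C' k \<in> carrier_mat m m"
    and BD': "\<forall>k<p. B' k \<in> carrier_mat n n \<and> D' k \<in> carrier_mat n n"
    and EF': "\<forall>k<p. E' k \<in> carrier_mat m n \<and> F' k \<in> carrier_mat m n"
    and XY': "\<forall>k<p. X' k \<in> carrier_mat m n \<and> Y' k \<in> carrier_mat m n"
    and pos: "\<forall>k<p. \<alpha> k > 0 \<and> \<beta> k > 0 \<and> \<gamma> k > 0 \<and> \<zeta> k > 0 \<and> \<tau> k > 0 \<and> \<delta> k > 0"
    and sol: "pgcs_eq p A B C D E F X Y"
  shows "pgcs_eq p (\<lambda>k. A k + A' k) (\<lambda>k. B k + B' k) (\<lambda>k. C k + C' k) (\<lambda>k. D k + D' k)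
      (\<lambda>k. E k + E' k) (\<lambda>k. F k + F' k) (\<lambda>k. X k + X' k) (\<lambda>k. Y k + Y' k)
    \<longleftrightarrow> pgcs_mat p m n A B C D *\<^sub>v vec_of_mat (interleave p m X' Y')
      + pgcs_mat p m n A' B' C' D' *\<^sub>v vec_of_mat (interleave p m X' Y')
      + H1 p m n \<alpha> \<beta> \<gamma> \<zeta> \<tau> \<delta> X Y *\<^sub>v scaled_perturbation p \<alpha> \<beta> \<gamma> \<zeta> \<tau> \<delta> A' B' C' D' E' F'
      = 0\<^sub>v (2 * p * m * n)" (is "?L \<longleftrightarrow> ?R")
proof -
  have c: "Suc k mod p < p" if "k < p" for k using that by simp
  define P Q where "P = (\<lambda>k. A k * X' k - Y' k * B k)"
    and "Q = (\<lambda>k. C k * X' (Suc k mod p) - Y' k * D k)"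
  define P' Q' where "P' = (\<lambda>k. A' k * X' k - Y' k * B' k)"
    and "Q' = (\<lambda>k. C' k * X' (Suc k mod p) - Y' k * D' k)"
  define R S where "R = (\<lambda>k. A' k * X k - Y k * B' k - E' k)"
    and "S = (\<lambda>k. C' k * X (Suc k mod p) - Y k * D' k - F' k)"
  have PQ: "\<forall>k<p. P k \<in> carrier_mat m n \<and> Q k \<in> carrier_mat m n"
    using BD XY' unfolding P_def Q_def by (fastforce intro!: minus_carrier_mat)
  have PQ': "\<forall>k<p. P' k \<in> carrier_mat m n \<and> Q' k \<in> carrier_mat m n"
    using BD' XY' unfolding P'_def Q'_def by (fastforce intro!: minus_carrier_mat)
  have RS: "\<forall>k<p. R k \<in> carrier_mat m n \<and> S k \<in> carrier_mat m n"
    using EF' unfolding R_def S_def by (auto intro!: minus_carrier_mat)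
  have PQ2: "\<forall>k<p. P k + P' k \<in> carrier_mat m n \<and> Q k + Q' k \<in> carrier_mat m n" using PQ PQ' by auto
  have sum: "\<forall>k<p. P k + P' k + R k \<in> carrier_mat m n \<and> Q k + Q' k + S k \<in> carrier_mat m n" using PQ2 RS by auto
  have Z: "\<forall>k<p. (0\<^sub>m m n :: real mat) \<in> carrier_mat m n \<and> (0\<^sub>m m n :: real mat) \<in> carrier_mat m n" by simp
  \<comment> \<open>The zero vector as a stacked family, so that injectivity applies.\<close>
  have zero: "vec_of_mat (interleave p m (\<lambda>k. 0\<^sub>m m n) (\<lambda>k. 0\<^sub>m m n)) = 0\<^sub>v (2 * p * m * n)"
  proof (rule eq_vecI)
    fix i assume "i < dim_vec (0\<^sub>v (2 * p * m * n))"
    then have i: "i < 2 * p * m * n" by simp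
    then have i': "i < (m * n) * (2 * p)" by (simp add: mult_ac)
    note r = mod_div_lt_mult(1)[OF i']
    show "vec_of_mat (interleave p m (\<lambda>k. 0\<^sub>m m n) (\<lambda>k. 0\<^sub>m m n)) $ i = (0\<^sub>v (2 * p * m * n) :: real vec) $ i"
      using i r mod_div_lt_mult[OF r] by (simp add: index_vec_of_mat_interleave[OF Z] index_vec_of_mat(1)[of _ m n])
  qed (simp add: dim_vec_of_mat_interleave[OF Z])
  have "?R \<longleftrightarrow> vec_of_mat (interleave p m (\<lambda>k. P k + P' k + R k) (\<lambda>k. Q k + Q' k + S k)) = 0\<^sub>v (2 * p * m * n)"
    unfolding pgcs_mat_mult_vec[OF AC BD XY'] pgcs_mat_mult_vec[OF AC' BD' XY']
      H1_mult_vec[OF XY AC' BD' EF' pos] vec_of_mat_interleave_add[OF PQ2 RS] vec_of_mat_interleave_add[OF PQ PQ']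
    unfolding P_def Q_def P'_def Q'_def R_def S_def ..
  also have "\<dots> \<longleftrightarrow> (\<forall>k<p. P k + P' k + R k = 0\<^sub>m m n \<and> Q k + Q' k + S k = 0\<^sub>m m n)"
    unfolding zero[symmetric] by (rule vec_of_mat_interleave_inject[OF sum Z])
  also have "\<dots> \<longleftrightarrow> ?L"
  proof -
    have "(A k + A' k) * (X k + X' k) - (Y k + Y' k) * (B k + B' k) = E k + E' k \<longleftrightarrow> P k + P' k + R k = 0\<^sub>m m n"
      if "k < p" for k
      unfolding P_def P'_def R_def using that AC AC' BD BD' XY XY' EF' sol
      by (intro perturbed_equation_iff) (simp_all add: pgcs_eq_def)
    moreover have "(C k + C' k) * (X (Suc k mod p) + X' (Suc k mod p)) - (Y k + Y' k) * (D k + D' k) = F k + F' k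
        \<longleftrightarrow> Q k + Q' k + S k = 0\<^sub>m m n"
      if "k < p" for k
      unfolding Q_def Q'_def S_def using that c[OF that] AC AC' BD BD' XY XY' EF' sol
      by (intro perturbed_equation_iff) (simp_all add: pgcs_eq_def)
    ultimately show ?thesis unfolding pgcs_eq_def by simp
  qed
  finally show ?thesis by blast
qed

lemma abs_vec_of_mat: "abs_vec (vec_of_mat M) = vec_of_mat (abs_mat M)"
  unfolding vec_of_mat_def by (intro eq_vecI) (auto simp: mod_div_lt_mult)

theorem theorem4p2:
  fixes p m n :: nat
    and A B C D E F X Y \<Delta>A \<Delta>B \<Delta>C \<Delta>D \<Delta>E \<Delta>F :: "nat \<Rightarrow> real mat"
    and \<alpha> \<beta> \<gamma> \<zeta> \<tau> \<delta> :: "nat \<Rightarrow> real"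
  defines "W \<equiv> pgcs_mat p m n A B C D"
    and "\<Delta>W \<equiv> pgcs_mat p m n \<Delta>A \<Delta>B \<Delta>C \<Delta>D"
    and "u \<equiv> scaled_perturbation p \<alpha> \<beta> \<gamma> \<zeta> \<tau> \<delta> \<Delta>A \<Delta>B \<Delta>C \<Delta>D \<Delta>E \<Delta>F"
    and "perturbed_solution \<equiv> (\<lambda>\<Delta>X \<Delta>Y.
      pgcs_eq p (\<lambda>k. A k + \<Delta>A k) (\<lambda>k. B k + \<Delta>B k) (\<lambda>k. C k + \<Delta>C k) (\<lambda>k. D k + \<Delta>D k)
        (\<lambda>k. E k + \<Delta>E k) (\<lambda>k. F k + \<Delta>F k) (\<lambda>k. X k + \<Delta>X k) (\<lambda>k. Y k + \<Delta>Y k))"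
  assumes "p \<ge> 1" "m \<ge> 1" "n \<ge> 1"
    and "\<forall>k<p. A k \<in> carrier_mat m m \<and> C k \<in> carrier_mat m m"
    and "\<forall>k<p. B k \<in> carrier_mat n n \<and> D k \<in> carrier_mat n n"
    and "\<forall>k<p. E k \<in> carrier_mat m n \<and> F k \<in> carrier_mat m n"
    and "\<forall>k<p. X k \<in> carrier_mat m n \<and> Y k \<in> carrier_mat m n"
    and "\<forall>k<p. \<Delta>A k \<in> carrier_mat m m \<and> \<Delta>C k \<in> carrier_mat m m"
    and "\<forall>k<p. \<Delta>B k \<in> carrier_mat n n \<and> \<Delta>D k \<in> carrier_mat n n"
    and "\<forall>k<p. \<Delta>E k \<in> carrier_mat m n \<and> \<Delta>F k \<in> carrier_mat m n"
    and "\<forall>k<p. \<alpha> k > 0 \<and> \<beta> k > 0 \<and> \<gamma> k > 0 \<and> \<zeta> k > 0 \<and> \<tau> k > 0 \<and> \<delta> k > 0"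
    and "invertible_mat W"
    and "pgcs_eq p A B C D E F X Y"
    and "spectral_radius (map_mat complex_of_real (abs_mat (inv_mat W * \<Delta>W))) < 1"
  shows "(\<exists>!Z \<in> ({..<p} \<rightarrow>\<^sub>E carrier_mat m n) \<times> ({..<p} \<rightarrow>\<^sub>E carrier_mat m n).
            perturbed_solution (fst Z) (snd Z)) \<and>
         invertible_mat (1\<^sub>m (2 * p * m * n) - abs_mat (inv_mat W * \<Delta>W)) \<and>
         (\<forall>\<Delta>X \<Delta>Y. (\<forall>k<p. \<Delta>X k \<in> carrier_mat m n \<and> \<Delta>Y k \<in> carrier_mat m n) \<longrightarrow>
            perturbed_solution \<Delta>X \<Delta>Y \<longrightarrow>
            vec_of_mat (abs_mat (interleave p m \<Delta>X \<Delta>Y))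
              \<le> inv_mat (1\<^sub>m (2 * p * m * n) - abs_mat (inv_mat W * \<Delta>W))
                  *\<^sub>v abs_vec (inv_mat W *\<^sub>v (H1 p m n \<alpha> \<beta> \<gamma> \<zeta> \<tau> \<delta> X Y *\<^sub>v u)))"
proof -
  let ?N = "2 * p * m * n"
  note AC = assms(8) and BD = assms(9) and XY = assms(11) and AC' = assms(12) and BD' = assms(13)
    and EF' = assms(14) and pos = assms(15) and sol = assms(17)
  define M where "M = inv_mat W * \<Delta>W"
  define h where "h = H1 p m n \<alpha> \<beta> \<gamma> \<zeta> \<tau> \<delta> X Y *\<^sub>v u"
  define b where "b = inv_mat W *\<^sub>v h"
  have W: "W \<in> carrier_mat ?N ?N" and \<Delta>W: "\<Delta>W \<in> carrier_mat ?N ?N"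
    unfolding W_def \<Delta>W_def by simp_all
  note Wi = inv_mat_invertible[OF W assms(16)]
  have M: "M \<in> carrier_mat ?N ?N" using Wi(1) \<Delta>W unfolding M_def by simp
  have sr: "spectral_radius (map_mat complex_of_real (abs_mat M)) < 1"
    using assms(18) unfolding M_def .
  \<comment> \<open>The length of \<open>h\<close> is read off its closed form as a stacked
    residual.\<close>
  have h: "h \<in> carrier_vec ?N"
  proof -
    have "\<forall>k<p. \<Delta>A k * X k - Y k * \<Delta>B k - \<Delta>E k \<in> carrier_mat m n
        \<and> \<Delta>C k * X (Suc k mod p) - Y k * \<Delta>D k - \<Delta>F k \<in> carrier_mat m n"
      using EF' by (auto intro!: minus_carrier_mat)
    from dim_vec_of_mat_interleave[OF this] show ?thesis
      unfolding h_def u_def H1_mult_vec[OF XY AC' BD' EF' pos] by (rule carrier_vecI)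
  qed
  have b: "b \<in> carrier_vec ?N" using Wi(1) h unfolding b_def by simp
  \<comment> \<open>W + \<Delta>W = W K, so the perturbed system is governed by
    \<open>K\<close>.\<close>
  define K where "K = 1\<^sub>m ?N + M"
  have K: "K \<in> carrier_mat ?N ?N" using M unfolding K_def by simp
  have invK: "invertible_mat K" unfolding K_def by (rule invertible_one_plus_mat[OF M sr])
  note Ki = inv_mat_invertible[OF K invK]
  have z: "vec_of_mat (interleave p m P Q) \<in> carrier_vec ?N"
    if "\<forall>k<p. P k \<in> carrier_mat m n \<and> Q k \<in> carrier_mat m n" for P Q
    using dim_vec_of_mat_interleave[OF that] by (rule carrier_vecI)
  \<comment> \<open>An equivalence, because existence and uniqueness are both drawn from it;
    multiplying by \<open>W\<close> undoes multiplying by its inverse.\<close>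
  have linear: "W *\<^sub>v v + \<Delta>W *\<^sub>v v + h = 0\<^sub>v ?N \<longleftrightarrow> K *\<^sub>v v = - b" (is "?r = _ \<longleftrightarrow> _")
    if v: "v \<in> carrier_vec ?N" for v
  proof -
    have Wv: "W *\<^sub>v v \<in> carrier_vec ?N" "\<Delta>W *\<^sub>v v \<in> carrier_vec ?N" using W \<Delta>W v by simp_all
    then have r: "?r \<in> carrier_vec ?N" using h by simp
    have "inv_mat W *\<^sub>v (W *\<^sub>v v) = v" "inv_mat W *\<^sub>v (\<Delta>W *\<^sub>v v) = M *\<^sub>v v"
      using Wi W \<Delta>W v unfolding M_def by (metis assoc_mult_mat_vec one_mult_mat_vec)+
    then have "inv_mat W *\<^sub>v ?r = (v + M *\<^sub>v v) + b"
      using Wi(1) Wv h unfolding b_def by (simp add: mult_add_distrib_mat_vec[of _ ?N ?N] del: assoc_add_vec)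
    also have "v + M *\<^sub>v v = K *\<^sub>v v"
      unfolding K_def using v M by (simp add: add_mult_distrib_mat_vec[of _ ?N ?N])
    finally have Kv: "inv_mat W *\<^sub>v ?r = K *\<^sub>v v + b" .
    have "?r = 0\<^sub>v ?N \<longleftrightarrow> inv_mat W *\<^sub>v ?r = 0\<^sub>v ?N"
    proof
      assume "inv_mat W *\<^sub>v ?r = 0\<^sub>v ?N"
      then have "W *\<^sub>v (inv_mat W *\<^sub>v ?r) = W *\<^sub>v 0\<^sub>v ?N" by simp
      moreover have "W *\<^sub>v (inv_mat W *\<^sub>v ?r) = ?r"
        using Wi W r by (metis assoc_mult_mat_vec one_mult_mat_vec)
      moreover have "W *\<^sub>v 0\<^sub>v ?N = 0\<^sub>v ?N" using W by (intro eq_vecI) auto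
      ultimately show "?r = 0\<^sub>v ?N" by simp
    next
      assume "?r = 0\<^sub>v ?N"
      moreover have "inv_mat W *\<^sub>v 0\<^sub>v ?N = 0\<^sub>v ?N" using Wi(1) by (intro eq_vecI) auto
      ultimately show "inv_mat W *\<^sub>v ?r = 0\<^sub>v ?N" by simp
    qed
    also have "\<dots> \<longleftrightarrow> K *\<^sub>v v = - b"
      unfolding Kv using K b by (auto simp: vec_eq_iff add_eq_0_iff2)
    finally show ?thesis .
  qed
  have perturbed: "perturbed_solution P Q \<longleftrightarrow> K *\<^sub>v vec_of_mat (interleave p m P Q) = - b"
    if PQ: "\<forall>k<p. P k \<in> carrier_mat m n \<and> Q k \<in> carrier_mat m n" for P Q
    using pgcs_perturbed_iff[OF AC BD XY AC' BD' EF' PQ pos sol] linear[OF z[OF PQ]]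
    unfolding perturbed_solution_def W_def \<Delta>W_def h_def u_def by simp
  have "\<exists>!Z \<in> ({..<p} \<rightarrow>\<^sub>E carrier_mat m n) \<times> ({..<p} \<rightarrow>\<^sub>E carrier_mat m n).
      perturbed_solution (fst Z) (snd Z)"
  proof -
    define z0 where "z0 = inv_mat K *\<^sub>v (- b)"
    have z0: "z0 \<in> carrier_vec ?N" using Ki(1) b unfolding z0_def by simp
    have Kz: "K *\<^sub>v v = - b \<longleftrightarrow> v = z0" if "v \<in> carrier_vec ?N" for v
      using Ki K b that unfolding z0_def
      by (metis assoc_mult_mat_vec one_mult_mat_vec uminus_carrier_vec)
    obtain P Q where P: "P \<in> {..<p} \<rightarrow>\<^sub>E carrier_mat m n" and Q: "Q \<in> {..<p} \<rightarrow>\<^sub>E carrier_mat m n"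
      and PQz: "vec_of_mat (interleave p m P Q) = z0"
      using vec_of_mat_interleave_surj[OF z0] .
    have PQ: "\<forall>k<p. P k \<in> carrier_mat m n \<and> Q k \<in> carrier_mat m n" using P Q by auto
    show ?thesis
    proof (rule ex1I[of _ "(P, Q)"])
      show "(P, Q) \<in> ({..<p} \<rightarrow>\<^sub>E carrier_mat m n) \<times> ({..<p} \<rightarrow>\<^sub>E carrier_mat m n)
          \<and> perturbed_solution (fst (P, Q)) (snd (P, Q))"
        using P Q perturbed[OF PQ] Kz[OF z0] PQz by simp
    next
      fix Z assume Z: "Z \<in> ({..<p} \<rightarrow>\<^sub>E carrier_mat m n) \<times> ({..<p} \<rightarrow>\<^sub>E carrier_mat m n)
          \<and> perturbed_solution (fst Z) (snd Z)"
      then have Z1: "fst Z \<in> {..<p} \<rightarrow>\<^sub>E carrier_mat m n" and Z2: "snd Z \<in> {..<p} \<rightarrow>\<^sub>E carrier_mat m n"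
        by (auto simp: mem_Times_iff)
      then have ZC: "\<forall>k<p. fst Z k \<in> carrier_mat m n \<and> snd Z k \<in> carrier_mat m n" by auto
      have "vec_of_mat (interleave p m (fst Z) (snd Z)) = vec_of_mat (interleave p m P Q)"
        using Z perturbed[OF ZC] Kz[OF z[OF ZC]] PQz by simp
      then have "\<forall>k<p. fst Z k = P k \<and> snd Z k = Q k"
        using vec_of_mat_interleave_inject[OF ZC PQ] by blast
      \<comment> \<open>Both functions are \<open>undefined\<close> outside k < p, so agreement
        below \<open>p\<close> is equality.\<close>
      then have "fst Z = P" "snd Z = Q"
        using PiE_ext[OF Z1 P] PiE_ext[OF Z2 Q] by auto
      then show "Z = (P, Q)" by (metis prod.collapse)
    qed
  qed
  moreover have "invertible_mat (1\<^sub>m ?N - abs_mat M)" by (rule invertible_one_minus_abs_mat[OF M sr])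
  moreover have "vec_of_mat (abs_mat (interleave p m P Q)) \<le> inv_mat (1\<^sub>m ?N - abs_mat M) *\<^sub>v abs_vec b"
    if PQ: "\<forall>k<p. P k \<in> carrier_mat m n \<and> Q k \<in> carrier_mat m n" and "perturbed_solution P Q" for P Q
  proof -
    let ?z = "vec_of_mat (interleave p m P Q)"
    have zc: "?z \<in> carrier_vec ?N" by (rule z[OF PQ])
    have "K *\<^sub>v ?z = - b" using that perturbed[OF PQ] by simp
    then have "?z + M *\<^sub>v ?z = - b"
      unfolding K_def using zc M by (simp add: add_mult_distrib_mat_vec[of _ ?N ?N])
    then have eq: "?z $ i + (M *\<^sub>v ?z) $ i = - (b $ i)" if "i < ?N" for i
      using that zc M b by (auto dest: arg_cong[of _ _ "\<lambda>x. x $ i"])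
    have "abs_vec ?z \<le> abs_vec b + abs_vec (M *\<^sub>v ?z)"
      unfolding less_eq_vec_def
    proof (intro conjI allI impI)
      fix i assume "i < dim_vec (abs_vec b + abs_vec (M *\<^sub>v ?z))"
      then have i: "i < ?N" using M by simp
      \<comment> \<open>Triangle inequality for z_i = - b_i - (M z)_i; the minus sign of the
        right-hand side disappears here.\<close>
      have "\<bar>?z $ i\<bar> \<le> \<bar>b $ i\<bar> + \<bar>(M *\<^sub>v ?z) $ i\<bar>" using eq[OF i] by linarith
      then show "abs_vec ?z $ i \<le> (abs_vec b + abs_vec (M *\<^sub>v ?z)) $ i"
        using i zc M b by (simp del: index_mult_mat_vec)
    qed (use zc M in simp)
    also have "\<dots> \<le> abs_vec b + abs_mat M *\<^sub>v abs_vec ?z"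
      using abs_mult_mat_vec_le[OF M zc] b M unfolding less_eq_vec_def by (auto simp del: index_mult_mat_vec)
    finally have "abs_vec ?z \<le> inv_mat (1\<^sub>m ?N - abs_mat M) *\<^sub>v abs_vec b"
      using zc b by (intro le_inv_one_minus_abs_mat[OF M sr]) simp_all
    then show ?thesis unfolding abs_vec_of_mat .
  qed
  ultimately show ?thesis unfolding M_def b_def h_def by blast
qed

end
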